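(* For each integer $M\ge 1$, let $h_1,\dots,h_{2M}$ be i.i.d. $\mathcal{CN}(0,1)$ and let $\gamma_1,\dots,\gamma_{2M}$ be i.i.d. positive random variables with density $f$, independent of the $h_i$. For a pairing, i.e. a partition of $\{1,\dots,2M\}$ into pairs $\{\ell_{2m-1},\ell_{2m}\}$, $m=1,\dots,M$, put $$R_m=\log_2\left(1+\gamma_{\ell_{2m-1}}|h_{\ell_{2m-1}}|^2+\gamma_{\ell_{2m}}|h_{\ell_{2m}}|^2\right),$$ and let the users be paired by a pairing that maximizes $\sum_{m=1}^M R_m$. Then, as $M\to\infty$, the average rate of the users satisfies $$\bar R=\frac{1}{2M}\sum_{m=1}^M R_m\longrightarrow \int_0^1\frac12\log_2\left(1+F^{-1}(t/2)+F^{-1}(1-t/2)\right)\,\mathrm{d}t\quad\text{in probability},$$ where $$F(z)=1-\int_{\mathbb{R}} e^{-z/x}f(x)\,\mathrm{d}x\qquad (z\ge 0)$$ and $F^{-1}$ denotes the inverse of $F$ with respect to composition.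
   Context: Setting: $2M$ single-antenna users send to a single-antenna base station over $M$ subcarriers, two users per subcarrier, with channels that are identical on all subcarriers (frequency-flat fading). $h_i$ is the small-scale fading coefficient and $\gamma_i$ the receive SNR of user $i$; $R_m$ is the sum rate of the pair on subcarrier $m$. The density $f$ is supported on $(0,\infty)$, so the integral defining $F$ is over positive $x$. $F$ is the cumulative distribution function of $\gamma_i|h_i|^2$. *)

theory Defs
  imports "HOL-Probability.Probability"
begin

definition std_complex_normal :: "'a measure \<Rightarrow> ('a \<Rightarrow> complex) \<Rightarrow> bool" where
  "std_complex_normal P X \<longleftrightarrow>
     distributed P lborel (\<lambda>\<omega>. Re (X \<omega>)) (normal_density 0 (sqrt (1/2))) \<and>
     distributed P lborel (\<lambda>\<omega>. Im (X \<omega>)) (normal_density 0 (sqrt (1/2))) \<and>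
     prob_space.indep_var P borel (\<lambda>\<omega>. Re (X \<omega>)) borel (\<lambda>\<omega>. Im (X \<omega>))"

text \<open>Unlike \<^const>\<open>prob_space.indep_var\<close>, this allows random variables with values in different types.\<close>

definition indep_rv ::
  "'a measure \<Rightarrow> 'b measure \<Rightarrow> ('a \<Rightarrow> 'b) \<Rightarrow> 'c measure \<Rightarrow> ('a \<Rightarrow> 'c) \<Rightarrow> bool" where
  "indep_rv P S X T Y \<longleftrightarrow>
     prob_space.indep_set P (sets (vimage_algebra (space P) X S)) (sets (vimage_algebra (space P) Y T))"

definition pairing :: "nat \<Rightarrow> (nat \<Rightarrow> nat) \<Rightarrow> bool" where
  "pairing M l \<longleftrightarrow>
     (\<forall>m\<in>{1..M}. l (2*m-1) \<noteq> l (2*m)) \<and>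
     disjoint_family_on (\<lambda>m. {l (2*m-1), l (2*m)}) {1..M} \<and>
     (\<Union>m\<in>{1..M}. {l (2*m-1), l (2*m)}) = {1..2*M}"

definition pair_rate :: "(nat \<Rightarrow> real) \<Rightarrow> (nat \<Rightarrow> complex) \<Rightarrow> (nat \<Rightarrow> nat) \<Rightarrow> nat \<Rightarrow> real" where
  "pair_rate g h l m =
     log 2 (1 + g (l (2*m-1)) * (cmod (h (l (2*m-1))))\<^sup>2 + g (l (2*m)) * (cmod (h (l (2*m))))\<^sup>2)"

definition optimal_pairing :: "nat \<Rightarrow> (nat \<Rightarrow> real) \<Rightarrow> (nat \<Rightarrow> complex) \<Rightarrow> (nat \<Rightarrow> nat) \<Rightarrow> bool" where
  "optimal_pairing M g h l \<longleftrightarrow>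
     pairing M l \<and>
     (\<forall>l'. pairing M l' \<longrightarrow> (\<Sum>m=1..M. pair_rate g h l' m) \<le> (\<Sum>m=1..M. pair_rate g h l m))"

definition average_rate :: "nat \<Rightarrow> (nat \<Rightarrow> real) \<Rightarrow> (nat \<Rightarrow> complex) \<Rightarrow> (nat \<Rightarrow> nat) \<Rightarrow> real" where
  "average_rate M g h l = 1 / (2 * real M) * (\<Sum>m=1..M. pair_rate g h l m)"

definition cdf_F :: "(real \<Rightarrow> real) \<Rightarrow> real \<Rightarrow> real" where
  "cdf_F f z = 1 - (LINT x:{0<..}|lborel. exp (- z / x) * f x)"

text \<open>The inverse is that of \<^term>\<open>cdf_F f\<close> as a map on \<open>[0, \<infinity>)\<close>; it is only used at points of \<open>(0, 1)\<close>.\<close>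

definition inv_F :: "(real \<Rightarrow> real) \<Rightarrow> real \<Rightarrow> real" where
  "inv_F f = inv_into {0..} (cdf_F f)"

text \<open>The limiting rate is \<open>\<infinity>\<close> if \<open>f\<close> has a sufficiently heavy tail, so it is taken as an
  extended nonnegative integral.\<close>

definition limit_rate :: "(real \<Rightarrow> real) \<Rightarrow> ennreal" where
  "limit_rate f =
     (\<integral>\<^sup>+t\<in>{0<..<1}. ennreal (1/2 * log 2 (1 + inv_F f (t/2) + inv_F f (1 - t/2))) \<partial>lborel)"

text \<open>Convergence in probability to a constant in \<open>[0, \<infinity>]\<close>. The variables may live on different
  probability spaces.\<close>

definition tendsto_in_prob :: "(nat \<Rightarrow> 'a measure) \<Rightarrow> (nat \<Rightarrow> 'a \<Rightarrow> real) \<Rightarrow> ennreal \<Rightarrow> bool" where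
  "tendsto_in_prob P X c \<longleftrightarrow>
     (\<forall>n. X n \<in> borel_measurable (P n)) \<and>
     (if c = \<infinity>
      then \<forall>K. (\<lambda>n. measure (P n) {\<omega> \<in> space (P n). X n \<omega> \<le> K}) \<longlonglongrightarrow> 0
      else \<forall>\<epsilon>>0. (\<lambda>n. measure (P n) {\<omega> \<in> space (P n). \<bar>X n \<omega> - enn2real c\<bar> > \<epsilon>}) \<longlonglongrightarrow> 0)"

end

theory Submission
  imports Defs
begin

text \<open>
  For \<open>a, b \<ge> 0\<close> one has
  \<open>ln (1 + a + b) = ln (1 + a) + ln (1 + b) - \<integral>\<integral> 1[s < a] 1[r < b] / (1 + s + r)\<^sup>2 ds dr\<close>.
  Summed over a pairing of \<open>z\<^sub>1, \<dots>, z\<^sub>n\<close>, the double integral counts the pairs, in both orders, with one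
  entry above \<open>s\<close> and the other above \<open>r\<close>; by the Frechet bound this count is at least
  \<open>n \<cdot> max 0 (G s + G r - 1)\<close> with \<open>G\<close> the empirical survival function, and equality holds for all
  \<open>s, r\<close> simultaneously if the largest value is paired with the smallest, and so on. Hence the optimal
  rate is \<open>\<Phi> G\<close> for the functional
  \<open>\<Phi> G = 2 \<integral> G s / (1 + s) ds - \<integral>\<integral> max 0 (G s + G r - 1) / (1 + s + r)\<^sup>2 ds dr\<close>, up to normalisation,
  and the limit is \<open>\<Phi>\<close> of the true survival function \<open>1 - F\<close>, because \<open>F\<^sup>-\<^sup>1(t/2)\<close> and
  \<open>F\<^sup>-\<^sup>1(1 - t/2)\<close> are coupled antimonotonically. Now \<open>\<Phi>\<close> is Lipschitz for the distance
  \<open>\<integral> \<bar>G - G'\<bar> / (1 + s) ds\<close>, whose expectation tends to \<open>0\<close> by dominated convergence since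
  \<open>E \<bar>G s - (1 - F s)\<bar> \<le> min (2 (1 - F s)) (1 / \<surd>n)\<close> by pairwise independence. If the limit is
  infinite, the optimal rate dominates \<open>\<integral> G s / (1 + s) ds\<close>, and it suffices to truncate this integral.
\<close>

section \<open>An integral representation of the pair rate\<close>

text \<open>The kernel \<open>1 / (1 + s + r)\<^sup>2\<close> is minus the mixed second derivative
  of \<open>ln (1 + s + r)\<close>. It is nonnegative, so a pairing whose overlap count is smallest
  at every \<open>(s, r)\<close> at once also has the largest sum rate. Its marginal
  \<open>1 / (1 + s)\<close> is the derivative of \<open>ln (1 + s)\<close>; hence one weighted L1
  distance controls both terms of \<open>\<Phi>\<close>, each with constant 2, and together they
  give the 4 in the final estimates. This weight has infinite total mass, so the bound
  \<open>1 / \<surd>n\<close> alone is not integrable; the other bound \<open>2 (1 - F s)\<close>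
  supplies the majorant, and it is integrable whenever the limit is finite.

  The obstacle is that the limit may be infinite, so integrals cannot be subtracted freely. Every
  identity is therefore kept in the additive form "rate + overlap = 2 * survival integral" over
  \<open>ennreal\<close>, and a term is cancelled only after it is known to be finite. No
  convergence of order statistics is needed: quantiles enter only through their superlevel sets,
  which are intervals.\<close>

definition log_measure :: "real set \<Rightarrow> real measure" where
  "log_measure A = density lborel (\<lambda>s. ennreal (indicator (A \<inter> {0..}) s / (1 + s)))"

definition pair_kernel :: "real \<Rightarrow> real \<Rightarrow> ennreal" where
  "pair_kernel s r = ennreal (indicator {0..} s * indicator {0..} r / (1 + s + r)\<^sup>2)"

text \<open>No maximum with \<open>0\<close> is needed here, as \<^const>\<open>ennreal\<close> sends negative numbers to \<open>0\<close>.\<close>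

definition overlap_integral :: "(real \<Rightarrow> real) \<Rightarrow> ennreal" where
  "overlap_integral H = (\<integral>\<^sup>+s. \<integral>\<^sup>+r. pair_kernel s r * ennreal (H s + H r - 1) \<partial>lborel \<partial>lborel)"

lemma sets_log_measure [measurable_cong, simp]: "sets (log_measure A) = sets borel"
  by (simp add: log_measure_def)

lemma space_log_measure [simp]: "space (log_measure A) = UNIV"
  by (simp add: log_measure_def)

lemma measurable_pair_kernel [measurable]:
  "(\<lambda>p. pair_kernel (fst p) (snd p)) \<in> borel_measurable (borel \<Otimes>\<^sub>M borel)"
  unfolding pair_kernel_def by measurable

lemma measurable_pair_kernel' [measurable (raw)]:
  "f \<in> borel_measurable M \<Longrightarrow> g \<in> borel_measurable M \<Longrightarrow> (\<lambda>x. pair_kernel (f x) (g x)) \<in> borel_measurable M"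
  using measurable_compose[OF measurable_Pair measurable_pair_kernel, of f M g] by simp

lemma pair_kernel_commute: "pair_kernel s r = pair_kernel r s"
  by (simp add: pair_kernel_def algebra_simps)

lemma nn_integral_log_measure:
  assumes "A \<in> sets borel" "g \<in> borel_measurable borel"
  shows "(\<integral>\<^sup>+s. g s \<partial>log_measure A) = (\<integral>\<^sup>+s. ennreal (indicator (A \<inter> {0..}) s / (1 + s)) * g s \<partial>lborel)"
  unfolding log_measure_def using assms by (subst nn_integral_density) auto

lemma sigma_finite_log_measure:
  assumes [measurable]: "A \<in> sets borel"
  shows "sigma_finite_measure (log_measure A)"
  unfolding log_measure_def
  by (subst sigma_finite_measure.sigma_finite_iff_density_finite[OF sigma_finite_lborel]) auto

lemma AE_log_measure_nonneg:
  assumes [measurable]: "A \<in> sets borel"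
  shows "AE s in log_measure A. 0 \<le> s"
  unfolding log_measure_def by (subst AE_density) (auto simp: indicator_def)

lemma nn_integral_log_measure_cong:
  assumes "A \<in> sets borel" "\<And>s. 0 \<le> s \<Longrightarrow> g s = h s"
  shows "(\<integral>\<^sup>+s. g s \<partial>log_measure A) = (\<integral>\<^sup>+s. h s \<partial>log_measure A)"
  by (rule nn_integral_cong_AE)
    (use AE_log_measure_nonneg[OF assms(1)] in eventually_elim, use assms(2) in simp)

section \<open>Explicit integrals of the weight and of the kernel\<close>

lemma emeasure_log_measure_less:
  assumes "0 \<le> a"
  shows "emeasure (log_measure UNIV) {..<a} = ennreal (ln (1 + a))"
proof -
  have "emeasure (log_measure UNIV) {..<a} = (\<integral>\<^sup>+s. indicator {..<a} s \<partial>log_measure UNIV)"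
    by simp
  also have "\<dots> = (\<integral>\<^sup>+s. ennreal (1 / (1 + s)) * indicator {0..a} s \<partial>lborel)"
    by (subst nn_integral_log_measure, simp, simp, rule nn_integral_cong_AE)
      (use AE_lborel_singleton[of a] in eventually_elim, auto simp: indicator_def)
  also have "\<dots> = ennreal (ln (1 + a) - ln (1 + 0))"
    by (rule nn_integral_FTC_Icc) (use assms in \<open>auto intro!: derivative_eq_intros\<close>)
  finally show ?thesis by simp
qed

lemma nn_integral_pair_kernel_less:
  assumes "0 \<le> s" "0 \<le> b"
  shows "(\<integral>\<^sup>+r. pair_kernel s r * indicator {..<b} r \<partial>lborel) = ennreal (1 / (1 + s) - 1 / (1 + s + b))"
proof -
  have "(\<integral>\<^sup>+r. pair_kernel s r * indicator {..<b} r \<partial>lborel)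
      = (\<integral>\<^sup>+r. ennreal (1 / (1 + s + r)\<^sup>2) * indicator {0..b} r \<partial>lborel)"
    by (rule nn_integral_cong_AE)
      (use AE_lborel_singleton[of b] in eventually_elim, use assms in \<open>auto simp: indicator_def pair_kernel_def\<close>)
  also have "\<dots> = ennreal (- (1 / (1 + s + b)) - (- (1 / (1 + s + 0))))"
    by (rule nn_integral_FTC_Icc)
      (use assms in \<open>auto intro!: derivative_eq_intros simp: power2_eq_square field_simps\<close>)
  finally show ?thesis by simp
qed

text \<open>The marginal of the kernel is exactly the density of \<open>log_measure UNIV\<close>.
  This is what reduces double integrals of functions of one variable to integrals against that
  measure.\<close>

lemma nn_integral_pair_kernel:
  "(\<integral>\<^sup>+r. pair_kernel s r \<partial>lborel) = ennreal (indicator {0..} s / (1 + s))"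
proof (cases "0 \<le> s")
  case True
  have "(\<integral>\<^sup>+r. pair_kernel s r \<partial>lborel) = (\<integral>\<^sup>+r. ennreal (1 / (1 + s + r)\<^sup>2) * indicator {0..} r \<partial>lborel)"
    by (rule nn_integral_cong) (use True in \<open>auto simp: indicator_def pair_kernel_def\<close>)
  also have "\<dots> = ennreal (0 - (- (1 / (1 + s + 0))))"
  proof (rule nn_integral_FTC_atLeast)
    show "((\<lambda>r. - (1 / (1 + s + r))) \<longlongrightarrow> 0) at_top"
      using tendsto_minus[OF tendsto_divide_0[OF tendsto_const filterlim_at_top_imp_at_infinity[OF
        filterlim_tendsto_add_at_top[OF tendsto_const filterlim_ident]]], of 1 "1 + s"] by simp
  qed (use True in \<open>auto intro!: derivative_eq_intros simp: power2_eq_square field_simps\<close>)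
  finally show ?thesis using True by simp
qed (simp add: pair_kernel_def)

text \<open>Integrating the kernel over the rectangle with sides \<open>a\<close> and
  \<open>b\<close>, first in \<open>r\<close> and then in \<open>s\<close>, leaves
  \<open>ln (1 + a) + ln (1 + b) - ln (1 + a + b)\<close>. The overlap is moved to the left so that
  nothing is subtracted in \<open>ennreal\<close>.\<close>

lemma ln_pair_decomposition:
  assumes "0 \<le> a" "0 \<le> b"
  shows "ennreal (ln (1 + a + b)) + (\<integral>\<^sup>+s. \<integral>\<^sup>+r. pair_kernel s r * (indicator {..<a} s * indicator {..<b} r) \<partial>lborel \<partial>lborel)
    = (\<integral>\<^sup>+s. indicator {..<a} s + indicator {..<b} s \<partial>log_measure UNIV)"
proof -
  have "(\<integral>\<^sup>+s. \<integral>\<^sup>+r. pair_kernel s r * (indicator {..<a} s * indicator {..<b} r) \<partial>lborel \<partial>lborel)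
      = (\<integral>\<^sup>+s. indicator {..<a} s * (\<integral>\<^sup>+r. pair_kernel s r * indicator {..<b} r \<partial>lborel) \<partial>lborel)"
    by (intro nn_integral_cong, subst nn_integral_cmult[symmetric]) (auto simp: ac_simps)
  also have "\<dots> = (\<integral>\<^sup>+s. ennreal (1 / (1 + s) - 1 / (1 + s + b)) * indicator {0..a} s \<partial>lborel)"
  proof (rule nn_integral_cong_AE)
    show "AE s in lborel. indicator {..<a} s * (\<integral>\<^sup>+r. pair_kernel s r * indicator {..<b} r \<partial>lborel)
      = ennreal (1 / (1 + s) - 1 / (1 + s + b)) * indicator {0..a} s"
      using AE_lborel_singleton[of a]
    proof eventually_elim
      case (elim s)
      show ?case
      proof (cases "0 \<le> s")
        case True
        then show ?thesis
          using elim assms by (subst nn_integral_pair_kernel_less) (auto simp: indicator_def)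
      qed (auto simp: pair_kernel_def)
    qed
  qed
  also have "\<dots> = ennreal ((ln (1 + a) - ln (1 + a + b)) - (ln (1 + 0) - ln (1 + 0 + b)))"
    by (rule nn_integral_FTC_Icc)
      (use assms in \<open>auto intro!: derivative_eq_intros simp: field_simps\<close>)
  finally have *: "(\<integral>\<^sup>+s. \<integral>\<^sup>+r. pair_kernel s r * (indicator {..<a} s * indicator {..<b} r) \<partial>lborel \<partial>lborel)
    = ennreal (ln (1 + a) + ln (1 + b) - ln (1 + a + b))" by (simp add: algebra_simps)
  \<comment> \<open>Subadditivity shows that the value of the double integral is nonnegative, so
    \<open>ennreal\<close> does not truncate it and the real identity carries over.\<close>
  have "ln (1 + a + b) \<le> ln ((1 + a) * (1 + b))"
    using assms by (intro ln_mono) (auto simp: algebra_simps)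
  then have "ln (1 + a + b) \<le> ln (1 + a) + ln (1 + b)"
    using assms by (simp add: ln_mult)
  then show ?thesis
    using assms unfolding *
    by (subst nn_integral_add) (auto simp: emeasure_log_measure_less ennreal_plus[symmetric] simp del: ennreal_plus)
qed

lemma ln_pair_ge:
  assumes "0 \<le> a" "0 \<le> b"
  shows "ln (1 + a) + ln (1 + b) \<le> 2 * ln (1 + a + b :: real)"
proof -
  have "ln (1 + a) \<le> ln (1 + a + b)" "ln (1 + b) \<le> ln (1 + a + b)"
    using assms by auto
  then show ?thesis by simp
qed

lemma nn_integral_pair_kernel_mult:
  assumes [measurable]: "g \<in> borel_measurable borel"
  shows "(\<integral>\<^sup>+s. \<integral>\<^sup>+r. pair_kernel s r * g s \<partial>lborel \<partial>lborel) = (\<integral>\<^sup>+s. g s \<partial>log_measure UNIV)"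
    and "(\<integral>\<^sup>+s. \<integral>\<^sup>+r. pair_kernel s r * g r \<partial>lborel \<partial>lborel) = (\<integral>\<^sup>+s. g s \<partial>log_measure UNIV)"
proof -
  show *: "(\<integral>\<^sup>+s. \<integral>\<^sup>+r. pair_kernel s r * g s \<partial>lborel \<partial>lborel) = (\<integral>\<^sup>+s. g s \<partial>log_measure UNIV)"
    by (simp add: nn_integral_multc nn_integral_pair_kernel nn_integral_log_measure)
  have "(\<integral>\<^sup>+s. \<integral>\<^sup>+r. pair_kernel s r * g r \<partial>lborel \<partial>lborel) = (\<integral>\<^sup>+r. \<integral>\<^sup>+s. pair_kernel s r * g r \<partial>lborel \<partial>lborel)"
    by (rule lborel_pair.Fubini') measurable
  also have "\<dots> = (\<integral>\<^sup>+s. \<integral>\<^sup>+r. pair_kernel s r * g s \<partial>lborel \<partial>lborel)"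
    by (simp only: pair_kernel_commute)
  finally show "(\<integral>\<^sup>+s. \<integral>\<^sup>+r. pair_kernel s r * g r \<partial>lborel \<partial>lborel) = (\<integral>\<^sup>+s. g s \<partial>log_measure UNIV)"
    using * by simp
qed

text \<open>The positive part is 1-Lipschitz, so the integrand changes by at most the deviation at
  \<open>s\<close> plus the deviation at \<open>r\<close>. Each of the two integrates against the
  kernel to the same weighted distance, hence the factor 2.\<close>

lemma overlap_integral_lipschitz:
  assumes [measurable]: "H \<in> borel_measurable borel" "H' \<in> borel_measurable borel"
  shows "overlap_integral H
    \<le> overlap_integral H' + 2 * (\<integral>\<^sup>+s. ennreal \<bar>H s - H' s\<bar> \<partial>log_measure UNIV)"
proof -
  have *: "ennreal (H s + H r - 1)
      \<le> ennreal (H' s + H' r - 1) + (ennreal \<bar>H s - H' s\<bar> + ennreal \<bar>H r - H' r\<bar>)" for s r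
  proof -
    \<comment> \<open>The explicit \<open>max 0\<close> makes both summands nonnegative, so that
      \<open>ennreal_plus\<close> can split them.\<close>
    have "ennreal (H s + H r - 1) \<le> ennreal (max 0 (H' s + H' r - 1) + (\<bar>H s - H' s\<bar> + \<bar>H r - H' r\<bar>))"
      by (intro ennreal_leI) linarith
    also have "\<dots> = ennreal (H' s + H' r - 1) + (ennreal \<bar>H s - H' s\<bar> + ennreal \<bar>H r - H' r\<bar>)"
      by (subst ennreal_plus) (auto simp: max_def ennreal_neg)
    finally show ?thesis .
  qed
  have "overlap_integral H \<le> (\<integral>\<^sup>+s. \<integral>\<^sup>+r. pair_kernel s r * ennreal (H' s + H' r - 1)
      + (pair_kernel s r * ennreal \<bar>H s - H' s\<bar> + pair_kernel s r * ennreal \<bar>H r - H' r\<bar>) \<partial>lborel \<partial>lborel)"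
    unfolding overlap_integral_def
    by (intro nn_integral_mono) (auto simp: distrib_left[symmetric] intro!: mult_left_mono *)
  also have "\<dots> = overlap_integral H' + ((\<integral>\<^sup>+s. \<integral>\<^sup>+r. pair_kernel s r * ennreal \<bar>H s - H' s\<bar> \<partial>lborel \<partial>lborel)
      + (\<integral>\<^sup>+s. \<integral>\<^sup>+r. pair_kernel s r * ennreal \<bar>H r - H' r\<bar> \<partial>lborel \<partial>lborel))"
    unfolding overlap_integral_def by (simp add: nn_integral_add)
  also have "\<dots> = overlap_integral H' + 2 * (\<integral>\<^sup>+s. ennreal \<bar>H s - H' s\<bar> \<partial>log_measure UNIV)"
    by (subst nn_integral_pair_kernel_mult, simp, subst nn_integral_pair_kernel_mult) (simp_all add: mult_2)
  finally show ?thesis .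
qed

text \<open>Because \<open>H r \<le> 1\<close>, the integrand is at most \<open>H s\<close>, and
  \<open>r\<close> can be integrated out. The bound serves to show that an overlap integral is
  finite, hence may be cancelled.\<close>

lemma overlap_integral_le:
  assumes [measurable]: "H \<in> borel_measurable borel" and "\<And>s. H s \<le> 1"
  shows "overlap_integral H \<le> (\<integral>\<^sup>+s. ennreal (H s) \<partial>log_measure UNIV)"
proof -
  have "overlap_integral H \<le> (\<integral>\<^sup>+s. \<integral>\<^sup>+r. pair_kernel s r * ennreal (H s) \<partial>lborel \<partial>lborel)"
    unfolding overlap_integral_def
    by (intro nn_integral_mono mult_left_mono ennreal_leI) (use assms(2) in \<open>auto simp: algebra_simps\<close>)
  also have "\<dots> = (\<integral>\<^sup>+s. ennreal (H s) \<partial>log_measure UNIV)"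
    by (rule nn_integral_pair_kernel_mult) simp
  finally show ?thesis .
qed

text \<open>The pointwise decomposition is integrated over \<open>\<mu>\<close> and Tonelli turns
  indicators into survival probabilities. The joint law of \<open>U\<close> and \<open>V\<close>
  enters only through the overlap term; the right-hand side depends on the marginals alone.\<close>

lemma nn_integral_ln_pair:
  assumes "sigma_finite_measure \<mu>"
    and [measurable]: "U \<in> borel_measurable \<mu>" "V \<in> borel_measurable \<mu>"
    and nonneg: "\<And>x. x \<in> space \<mu> \<Longrightarrow> 0 \<le> U x" "\<And>x. x \<in> space \<mu> \<Longrightarrow> 0 \<le> V x"
  shows "(\<integral>\<^sup>+x. ennreal (ln (1 + U x + V x)) \<partial>\<mu>)
      + (\<integral>\<^sup>+s. \<integral>\<^sup>+r. pair_kernel s r * emeasure \<mu> {x \<in> space \<mu>. s < U x \<and> r < V x} \<partial>lborel \<partial>lborel)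
    = (\<integral>\<^sup>+s. emeasure \<mu> {x \<in> space \<mu>. s < U x} + emeasure \<mu> {x \<in> space \<mu>. s < V x} \<partial>log_measure UNIV)"
proof -
  interpret \<mu>: sigma_finite_measure \<mu> by fact
  interpret S: sigma_finite_measure "log_measure UNIV" by (rule sigma_finite_log_measure) simp
  interpret pair_sigma_finite \<mu> lborel ..
  interpret S: pair_sigma_finite \<mu> "log_measure UNIV" ..
  \<comment> \<open>Written with \<open>if\<close>, the integrands are visibly jointly measurable in
    \<open>x\<close>, \<open>s\<close> and \<open>r\<close>, as Tonelli requires.\<close>
  have ind: "indicator {..<a} s = (if s < a then 1 else 0 :: ennreal)" for a s :: real
    by (simp add: indicator_def)
  have em: "(\<integral>\<^sup>+x. (if P x then 1 else 0) \<partial>\<mu>) = emeasure \<mu> {x \<in> space \<mu>. P x}"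
    if [measurable]: "Measurable.pred \<mu> P" for P
  proof -
    have "(\<integral>\<^sup>+x. (if P x then 1 else 0) \<partial>\<mu>) = (\<integral>\<^sup>+x. indicator {x \<in> space \<mu>. P x} x \<partial>\<mu>)"
      by (intro nn_integral_cong) (simp add: indicator_def)
    then show ?thesis by simp
  qed
  have "(\<integral>\<^sup>+x. \<integral>\<^sup>+s. \<integral>\<^sup>+r. pair_kernel s r * (indicator {..<U x} s * indicator {..<V x} r) \<partial>lborel \<partial>lborel \<partial>\<mu>)
      = (\<integral>\<^sup>+s. \<integral>\<^sup>+x. \<integral>\<^sup>+r. pair_kernel s r * (indicator {..<U x} s * indicator {..<V x} r) \<partial>lborel \<partial>\<mu> \<partial>lborel)"
    unfolding ind by (rule Fubini'[symmetric]) measurable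
  also have "\<dots> = (\<integral>\<^sup>+s. \<integral>\<^sup>+r. \<integral>\<^sup>+x. pair_kernel s r * (indicator {..<U x} s * indicator {..<V x} r) \<partial>\<mu> \<partial>lborel \<partial>lborel)"
    unfolding ind by (intro nn_integral_cong, rule Fubini'[symmetric]) measurable
  also have "\<dots> = (\<integral>\<^sup>+s. \<integral>\<^sup>+r. pair_kernel s r * emeasure \<mu> {x \<in> space \<mu>. s < U x \<and> r < V x} \<partial>lborel \<partial>lborel)"
  proof (intro nn_integral_cong)
    fix s r
    have "(\<integral>\<^sup>+x. pair_kernel s r * (indicator {..<U x} s * indicator {..<V x} r) \<partial>\<mu>)
      = pair_kernel s r * (\<integral>\<^sup>+x. (if s < U x \<and> r < V x then 1 else 0) \<partial>\<mu>)"
      by (subst nn_integral_cmult[symmetric]) (auto intro!: nn_integral_cong)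
    then show "(\<integral>\<^sup>+x. pair_kernel s r * (indicator {..<U x} s * indicator {..<V x} r) \<partial>\<mu>)
      = pair_kernel s r * emeasure \<mu> {x \<in> space \<mu>. s < U x \<and> r < V x}"
      by (subst (asm) em) auto
  qed
  finally have 1: "(\<integral>\<^sup>+x. \<integral>\<^sup>+s. \<integral>\<^sup>+r. pair_kernel s r * (indicator {..<U x} s * indicator {..<V x} r) \<partial>lborel \<partial>lborel \<partial>\<mu>)
    = (\<integral>\<^sup>+s. \<integral>\<^sup>+r. pair_kernel s r * emeasure \<mu> {x \<in> space \<mu>. s < U x \<and> r < V x} \<partial>lborel \<partial>lborel)" .
  have "(\<integral>\<^sup>+x. \<integral>\<^sup>+s. indicator {..<U x} s + indicator {..<V x} s \<partial>log_measure UNIV \<partial>\<mu>)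
      = (\<integral>\<^sup>+s. \<integral>\<^sup>+x. indicator {..<U x} s + indicator {..<V x} s \<partial>\<mu> \<partial>log_measure UNIV)"
    unfolding ind by (rule S.Fubini'[symmetric]) measurable
  also have "\<dots> = (\<integral>\<^sup>+s. emeasure \<mu> {x \<in> space \<mu>. s < U x} + emeasure \<mu> {x \<in> space \<mu>. s < V x} \<partial>log_measure UNIV)"
    unfolding ind by (intro nn_integral_cong, subst nn_integral_add) (auto simp: em)
  finally have 2: "(\<integral>\<^sup>+x. \<integral>\<^sup>+s. indicator {..<U x} s + indicator {..<V x} s \<partial>log_measure UNIV \<partial>\<mu>)
    = (\<integral>\<^sup>+s. emeasure \<mu> {x \<in> space \<mu>. s < U x} + emeasure \<mu> {x \<in> space \<mu>. s < V x} \<partial>log_measure UNIV)" .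
  have "(\<integral>\<^sup>+x. ennreal (ln (1 + U x + V x)) + (\<integral>\<^sup>+s. \<integral>\<^sup>+r. pair_kernel s r * (indicator {..<U x} s * indicator {..<V x} r) \<partial>lborel \<partial>lborel) \<partial>\<mu>)
      = (\<integral>\<^sup>+x. \<integral>\<^sup>+s. indicator {..<U x} s + indicator {..<V x} s \<partial>log_measure UNIV \<partial>\<mu>)"
    using nonneg by (intro nn_integral_cong ln_pair_decomposition) auto
  moreover have "(\<integral>\<^sup>+x. ennreal (ln (1 + U x + V x)) + (\<integral>\<^sup>+s. \<integral>\<^sup>+r. pair_kernel s r * (indicator {..<U x} s * indicator {..<V x} r) \<partial>lborel \<partial>lborel) \<partial>\<mu>)
    = (\<integral>\<^sup>+x. ennreal (ln (1 + U x + V x)) \<partial>\<mu>) + (\<integral>\<^sup>+x. (\<integral>\<^sup>+s. \<integral>\<^sup>+r. pair_kernel s r * (indicator {..<U x} s * indicator {..<V x} r) \<partial>lborel \<partial>lborel) \<partial>\<mu>)"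
    unfolding ind by (rule nn_integral_add) measurable
  ultimately show ?thesis
    unfolding 1 2 by simp
qed

text \<open>Used with \<open>X\<close> the empirical and \<open>L\<close> the limiting sum rate, \<open>J\<close> and \<open>J'\<close> the overlap integrals
  and \<open>D\<close> the distance of the survival functions.\<close>

lemma ennreal_sandwich:
  fixes X L I I' J J' D :: ennreal
  assumes "X + J' = 2 * I'" "L + J = 2 * I" "I' \<le> I + D" "J \<le> J' + 2 * D" "J' < \<infinity>"
  shows "X \<le> L + 4 * D"
proof -
  have "X + J' \<le> 2 * (I + D)"
    unfolding assms(1) by (intro mult_left_mono assms) simp
  also have "\<dots> = L + J + 2 * D"
    by (simp add: assms(2) distrib_left)
  also have "\<dots> \<le> L + (J' + 2 * D) + 2 * D"
    by (intro add_mono assms order_refl)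
  also have "\<dots> = (L + 4 * D) + J'"
    using distrib_right[of 2 2 D] by (simp add: ac_simps)
  \<comment> \<open>An infinite \<open>J'\<close> could not be cancelled, which is where the
    finiteness assumption enters.\<close>
  finally show ?thesis
    using assms(5) by (auto simp: add.commute[of _ J'] ennreal_add_left_cancel_le)
qed

section \<open>Pairings\<close>

definition empirical_survival :: "nat \<Rightarrow> (nat \<Rightarrow> real) \<Rightarrow> real \<Rightarrow> real" where
  "empirical_survival n z s = (\<Sum>i=1..n. of_bool (s < z i)) / real n"

lemma empirical_survival_nonneg: "0 \<le> empirical_survival n z s"
  by (simp add: empirical_survival_def sum_nonneg)

lemma empirical_survival_le_1: "empirical_survival n z s \<le> 1"
proof -
  have "(\<Sum>i=1..n. of_bool (s < z i)) \<le> (\<Sum>i=1..n. (1 :: real))"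
    by (intro sum_mono) auto
  then show ?thesis by (auto simp: empirical_survival_def divide_le_eq_1)
qed

lemma borel_measurable_empirical_survival [measurable]:
  "empirical_survival n z \<in> borel_measurable borel"
proof -
  have "empirical_survival n z = (\<lambda>s. (\<Sum>i=1..n. (if s < z i then 1 else 0)) / real n)"
    by (auto simp: empirical_survival_def fun_eq_iff of_bool_def)
  also have "\<dots> \<in> borel_measurable borel" by measurable
  finally show ?thesis .
qed

lemma pairs_Union: "(\<Union>m\<in>{1..M}. {2*m-1, 2*m}) = {1..2*M::nat}"
proof -
  have "k \<in> (\<Union>m\<in>{1..M}. {2*m-1, 2*m})" if "k \<in> {1..2*M}" for k
    using that by (intro UN_I[of "(k + 1) div 2"]) auto
  then show ?thesis by auto
qed

text \<open>A map of \<open>2 * M\<close> points onto a set of \<open>2 * M\<close> elements is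
  injective by counting; conversely, injectivity separates the consecutive index pairs. In this form
  sums over the pairs reindex to sums over the users.\<close>

lemma pairing_iff_bij_betw: "pairing M l \<longleftrightarrow> bij_betw l {1..2*M} {1..2*M}"
proof
  assume l: "pairing M l"
  have "l ` {1..2*M} = (\<Union>m\<in>{1..M}. {l (2*m-1), l (2*m)})"
    unfolding pairs_Union[symmetric] by auto
  then have "l ` {1..2*M} = {1..2*M}"
    using l by (simp add: pairing_def)
  then show "bij_betw l {1..2*M} {1..2*M}"
    by (simp add: bij_betw_def eq_card_imp_inj_on)
next
  assume l: "bij_betw l {1..2*M} {1..2*M}"
  then have inj: "l i = l j \<longleftrightarrow> i = j" if "i \<in> {1..2*M}" "j \<in> {1..2*M}" for i j
    using that inj_on_eq_iff[OF bij_betw_imp_inj_on[OF l]] by blast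
  have "(\<Union>m\<in>{1..M}. {l (2*m-1), l (2*m)}) = l ` {1..2*M}"
    unfolding pairs_Union[symmetric] by auto
  then have cover: "(\<Union>m\<in>{1..M}. {l (2*m-1), l (2*m)}) = {1..2*M}"
    using bij_betw_imp_surj_on[OF l] by simp
  have neq: "l (2*m-1) \<noteq> l (2*m)" if "m \<in> {1..M}" for m
    using that by (subst inj) auto
  have disj: "{l (2*m-1), l (2*m)} \<inter> {l (2*k-1), l (2*k)} = {}"
    if "m \<in> {1..M}" "k \<in> {1..M}" "m \<noteq> k" for m k
  proof -
    have "2*m-1 \<noteq> 2*k" "2*m \<noteq> 2*k-1" "2*m-1 \<noteq> 2*k-1" "2*m \<noteq> 2*k"
      using that unfolding atLeastAtMost_iff by presburger+
    moreover have "2*m-1 \<in> {1..2*M}" "2*m \<in> {1..2*M}" "2*k-1 \<in> {1..2*M}" "2*k \<in> {1..2*M}"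
      using that by auto
    ultimately show ?thesis by (simp add: inj)
  qed
  show "pairing M l"
    unfolding pairing_def disjoint_family_on_def
    using cover by (intro conjI ballI impI neq disj) simp_all
qed

lemma sum_pairs:
  fixes F :: "nat \<Rightarrow> real"
  shows "(\<Sum>m=1..M. F (2*m-1) + F (2*m)) = (\<Sum>k=1..2*M. F k)"
  by (induction M) simp_all

lemma sum_pairing:
  fixes F :: "nat \<Rightarrow> real"
  assumes "pairing M l"
  shows "(\<Sum>m=1..M. F (l (2*m-1)) + F (l (2*m))) = (\<Sum>k=1..2*M. F k)"
proof -
  have "(\<Sum>m=1..M. F (l (2*m-1)) + F (l (2*m))) = (\<Sum>k=1..2*M. F (l k))"
    by (rule sum_pairs)
  also have "\<dots> = (\<Sum>k=1..2*M. F k)"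
    using assms by (intro sum.reindex_bij_betw) (simp add: pairing_iff_bij_betw)
  finally show ?thesis .
qed

section \<open>Overlap counts of a pairing and the Frechet bound\<close>

definition pair_overlap :: "nat \<Rightarrow> (nat \<Rightarrow> real) \<Rightarrow> (nat \<Rightarrow> nat) \<Rightarrow> real \<Rightarrow> real \<Rightarrow> real" where
  "pair_overlap M z l s r =
     (\<Sum>m=1..M. of_bool (s < z (l (2*m-1)) \<and> r < z (l (2*m))) + of_bool (s < z (l (2*m)) \<and> r < z (l (2*m-1))))"

definition sum_ln_rate :: "nat \<Rightarrow> (nat \<Rightarrow> real) \<Rightarrow> (nat \<Rightarrow> nat) \<Rightarrow> real" where
  "sum_ln_rate M z l = (\<Sum>m=1..M. ln (1 + z (l (2*m-1)) + z (l (2*m))))"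

lemma sum_survival_pairs:
  assumes "pairing M l"
  shows "(\<Sum>m=1..M. (of_bool (s < z (l (2*m-1))) + of_bool (s < z (l (2*m))) :: real))
    = 2 * real M * empirical_survival (2*M) z s"
  using sum_pairing[OF assms, of "\<lambda>i. of_bool (s < z i)"] by (simp add: empirical_survival_def)

text \<open>The constant \<open>2 * M\<close> is spread over the pairs, 2 for each, so that the
  Frechet expression can be compared with \<open>pair_overlap\<close> one pair at a time.\<close>

lemma scaled_survival_sum:
  assumes "pairing M l"
  shows "2 * real M * (empirical_survival (2*M) z s + empirical_survival (2*M) z r - 1)
    = (\<Sum>m=1..M. (of_bool (s < z (l (2*m-1))) + of_bool (s < z (l (2*m))))
        + (of_bool (r < z (l (2*m-1))) + of_bool (r < z (l (2*m)))) - 2)"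
proof -
  define A where "A s m = (of_bool (s < z (l (2*m-1))) + of_bool (s < z (l (2*m))) :: real)" for s m
  have "(\<Sum>m=1..M. A t m) = 2 * real M * empirical_survival (2*M) z t" for t
    unfolding A_def by (rule sum_survival_pairs[OF assms])
  then have "(\<Sum>m=1..M. A s m + A r m - 2) = 2 * real M * (empirical_survival (2*M) z s + empirical_survival (2*M) z r - 1)"
    by (simp add: sum.distrib sum_subtractf algebra_simps)
  then show ?thesis by (simp only: A_def)
qed

text \<open>For two events, \<open>of_bool A + of_bool B - 1 \<le> of_bool (A \<and> B)\<close>.
  This is applied in each pair to both assignments of the thresholds \<open>s\<close> and
  \<open>r\<close> to the two users.\<close>

lemma pair_overlap_ge:
  assumes "pairing M l"
  shows "2 * real M * (empirical_survival (2*M) z s + empirical_survival (2*M) z r - 1) \<le> pair_overlap M z l s r"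
proof -
  have "2 * real M * (empirical_survival (2*M) z s + empirical_survival (2*M) z r - 1)
    = (\<Sum>m=1..M. (of_bool (s < z (l (2*m-1))) + of_bool (s < z (l (2*m))))
        + (of_bool (r < z (l (2*m-1))) + of_bool (r < z (l (2*m)))) - 2)"
    by (rule scaled_survival_sum[OF assms])
  also have "\<dots> \<le> pair_overlap M z l s r"
    unfolding pair_overlap_def by (intro sum_mono) auto
  finally show ?thesis .
qed

text \<open>The decomposition is summed over the pairs twice, once for each order of the two users,
  because \<open>pair_overlap\<close> is symmetrised; hence the factors 2.\<close>

lemma sum_ln_rate_identity:
  assumes l: "pairing M l" and z: "\<And>i. i \<in> {1..2*M} \<Longrightarrow> 0 \<le> z i"
  shows "2 * ennreal (sum_ln_rate M z l)
      + (\<integral>\<^sup>+s. \<integral>\<^sup>+r. pair_kernel s r * ennreal (pair_overlap M z l s r) \<partial>lborel \<partial>lborel)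
    = 2 * (ennreal (2 * real M) * (\<integral>\<^sup>+s. ennreal (empirical_survival (2*M) z s) \<partial>log_measure UNIV))"
proof -
  define a where "a m = z (l (2*m-1))" for m
  define b where "b m = z (l (2*m))" for m
  have ab: "0 \<le> a m" "0 \<le> b m" if "m \<in> {1..M}" for m
  proof -
    have "2*m-1 \<in> {1..2*M}" "2*m \<in> {1..2*M}" using that by auto
    then have "l (2*m-1) \<in> {1..2*M}" "l (2*m) \<in> {1..2*M}"
      using bij_betw_apply[OF l[unfolded pairing_iff_bij_betw]] by simp_all
    then show "0 \<le> a m" "0 \<le> b m" by (auto simp: a_def b_def intro: z)
  qed
  have ind: "indicator {..<x} s = ennreal (if s < x then 1 else 0)" for s x :: real
    by (simp add: indicator_def)
  \<comment> \<open>The sequences \<open>f\<close> and \<open>g\<close> stay arbitrary here, as the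
    statement is used for \<open>(a, b)\<close> and for \<open>(b, a)\<close>.\<close>
  have dec: "ennreal (\<Sum>m=1..M. ln (1 + f m + g m))
      + (\<integral>\<^sup>+s. \<integral>\<^sup>+r. pair_kernel s r * ennreal (\<Sum>m=1..M. of_bool (s < f m \<and> r < g m)) \<partial>lborel \<partial>lborel)
    = (\<integral>\<^sup>+s. ennreal (\<Sum>m=1..M. of_bool (s < f m) + of_bool (s < g m)) \<partial>log_measure UNIV)"
    if fg: "\<And>m. m \<in> {1..M} \<Longrightarrow> 0 \<le> f m" "\<And>m. m \<in> {1..M} \<Longrightarrow> 0 \<le> g m" for f g :: "nat \<Rightarrow> real"
  proof -
    have "(\<Sum>m=1..M. ennreal (ln (1 + f m + g m))
        + (\<integral>\<^sup>+s. \<integral>\<^sup>+r. pair_kernel s r * (indicator {..<f m} s * indicator {..<g m} r) \<partial>lborel \<partial>lborel))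
      = (\<Sum>m=1..M. \<integral>\<^sup>+s. indicator {..<f m} s + indicator {..<g m} s \<partial>log_measure UNIV)"
      using fg by (intro sum.cong ln_pair_decomposition) auto
    moreover have "(\<Sum>m=1..M. ennreal (ln (1 + f m + g m))) = ennreal (\<Sum>m=1..M. ln (1 + f m + g m))"
      using fg by (intro sum_ennreal) (auto simp: add_nonneg_nonneg)
    moreover have "(\<Sum>m=1..M. \<integral>\<^sup>+s. indicator {..<f m} s + indicator {..<g m} s \<partial>log_measure UNIV)
      = (\<integral>\<^sup>+s. ennreal (\<Sum>m=1..M. of_bool (s < f m) + of_bool (s < g m)) \<partial>log_measure UNIV)"
      unfolding ind
      by (subst nn_integral_sum[symmetric])
        (auto simp: of_bool_def ennreal_plus[symmetric] sum_ennreal simp del: ennreal_plus intro!: nn_integral_cong)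
    moreover have "(\<Sum>m=1..M. \<integral>\<^sup>+s. \<integral>\<^sup>+r. pair_kernel s r * (indicator {..<f m} s * indicator {..<g m} r) \<partial>lborel \<partial>lborel)
      = (\<integral>\<^sup>+s. \<integral>\<^sup>+r. (\<Sum>m=1..M. pair_kernel s r * (indicator {..<f m} s * indicator {..<g m} r)) \<partial>lborel \<partial>lborel)"
      unfolding ind
      by (subst nn_integral_sum[symmetric]) (auto intro!: nn_integral_cong nn_integral_sum[symmetric])
    moreover have "(\<Sum>m=1..M. pair_kernel s r * (indicator {..<f m} s * indicator {..<g m} r))
      = pair_kernel s r * ennreal (\<Sum>m=1..M. of_bool (s < f m \<and> r < g m))" for s r
    proof -
      have "(\<Sum>m=1..M. indicator {..<f m} s * indicator {..<g m} r) = (\<Sum>m=1..M. ennreal (of_bool (s < f m \<and> r < g m)))"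
        unfolding ind by (intro sum.cong) auto
      also have "\<dots> = ennreal (\<Sum>m=1..M. of_bool (s < f m \<and> r < g m))"
        by (rule sum_ennreal) simp
      finally show ?thesis by (simp only: sum_distrib_left[symmetric])
    qed
    ultimately show ?thesis by (simp add: sum.distrib)
  qed
  have "2 * ennreal (sum_ln_rate M z l)
      + (\<integral>\<^sup>+s. \<integral>\<^sup>+r. pair_kernel s r * ennreal (pair_overlap M z l s r) \<partial>lborel \<partial>lborel)
    = (ennreal (\<Sum>m=1..M. ln (1 + a m + b m))
        + (\<integral>\<^sup>+s. \<integral>\<^sup>+r. pair_kernel s r * ennreal (\<Sum>m=1..M. of_bool (s < a m \<and> r < b m)) \<partial>lborel \<partial>lborel))
      + (ennreal (\<Sum>m=1..M. ln (1 + b m + a m))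
        + (\<integral>\<^sup>+s. \<integral>\<^sup>+r. pair_kernel s r * ennreal (\<Sum>m=1..M. of_bool (s < b m \<and> r < a m)) \<partial>lborel \<partial>lborel))"
  proof -
    have "(\<integral>\<^sup>+s. \<integral>\<^sup>+r. pair_kernel s r * ennreal (pair_overlap M z l s r) \<partial>lborel \<partial>lborel)
      = (\<integral>\<^sup>+s. \<integral>\<^sup>+r. pair_kernel s r * ennreal (\<Sum>m=1..M. if s < a m \<and> r < b m then 1 else 0)
          + pair_kernel s r * ennreal (\<Sum>m=1..M. if s < b m \<and> r < a m then 1 else 0) \<partial>lborel \<partial>lborel)"
      unfolding distrib_left[symmetric] of_bool_def[symmetric]
      by (subst ennreal_plus[symmetric])
        (auto simp: pair_overlap_def sum.distrib a_def b_def simp del: sum_of_bool_eq intro!: sum_nonneg)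
    also have "\<dots> = (\<integral>\<^sup>+s. \<integral>\<^sup>+r. pair_kernel s r * ennreal (\<Sum>m=1..M. if s < a m \<and> r < b m then 1 else 0) \<partial>lborel \<partial>lborel)
          + (\<integral>\<^sup>+s. \<integral>\<^sup>+r. pair_kernel s r * ennreal (\<Sum>m=1..M. if s < b m \<and> r < a m then 1 else 0) \<partial>lborel \<partial>lborel)"
      by (simp add: nn_integral_add)
    finally have 1: "(\<integral>\<^sup>+s. \<integral>\<^sup>+r. pair_kernel s r * ennreal (pair_overlap M z l s r) \<partial>lborel \<partial>lborel)
      = (\<integral>\<^sup>+s. \<integral>\<^sup>+r. pair_kernel s r * ennreal (\<Sum>m=1..M. of_bool (s < a m \<and> r < b m)) \<partial>lborel \<partial>lborel)
          + (\<integral>\<^sup>+s. \<integral>\<^sup>+r. pair_kernel s r * ennreal (\<Sum>m=1..M. of_bool (s < b m \<and> r < a m)) \<partial>lborel \<partial>lborel)"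
      by (simp only: of_bool_def)
    have 2: "(\<Sum>m=1..M. ln (1 + b m + a m)) = sum_ln_rate M z l" "(\<Sum>m=1..M. ln (1 + a m + b m)) = sum_ln_rate M z l"
      by (simp_all add: sum_ln_rate_def a_def b_def ac_simps)
    show ?thesis unfolding 1 2 by (simp add: mult_2 ac_simps)
  qed
  also have "\<dots> = (\<integral>\<^sup>+s. ennreal (\<Sum>m=1..M. of_bool (s < a m) + of_bool (s < b m)) \<partial>log_measure UNIV)
      + (\<integral>\<^sup>+s. ennreal (\<Sum>m=1..M. of_bool (s < b m) + of_bool (s < a m)) \<partial>log_measure UNIV)"
    by (subst (1 2) dec) (auto simp: ab)
  also have "\<dots> = 2 * (\<integral>\<^sup>+s. ennreal (2 * real M * empirical_survival (2*M) z s) \<partial>log_measure UNIV)"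
    unfolding sum_survival_pairs[OF l, symmetric] a_def b_def by (simp add: add.commute mult_2)
  also have "\<dots> = 2 * (ennreal (2 * real M) * (\<integral>\<^sup>+s. ennreal (empirical_survival (2*M) z s) \<partial>log_measure UNIV))"
    by (subst nn_integral_cmult[symmetric]) (auto simp: ennreal_mult' empirical_survival_nonneg)
  finally show ?thesis .
qed

lemma borel_measurable_overlap_section [measurable]:
  assumes [measurable]: "H \<in> borel_measurable borel"
  shows "(\<lambda>r. pair_kernel s r * ennreal (H s + H r - 1)) \<in> borel_measurable lborel"
  by measurable

lemma borel_measurable_overlap_integral [measurable]:
  assumes [measurable]: "H \<in> borel_measurable borel"
  shows "(\<lambda>s. \<integral>\<^sup>+r. pair_kernel s r * ennreal (H s + H r - 1) \<partial>lborel) \<in> borel_measurable lborel"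
  by measurable

text \<open>Truncation at 0 commutes with multiplication by a nonnegative constant, so the factor
  can be moved inside and compared with the integer overlap counts.\<close>

lemma overlap_integral_scaled:
  "ennreal (2 * real M) * overlap_integral (empirical_survival (2*M) z)
    = (\<integral>\<^sup>+s. \<integral>\<^sup>+r. pair_kernel s r
        * ennreal (2 * real M * (empirical_survival (2*M) z s + empirical_survival (2*M) z r - 1)) \<partial>lborel \<partial>lborel)"
  unfolding overlap_integral_def
proof -
  have "ennreal (2 * real M) * (pair_kernel s r * ennreal x) = pair_kernel s r * ennreal (2 * real M * x)" for s r x
    by (subst ennreal_mult') (simp_all only: mult.left_commute zero_le_mult_iff of_nat_0_le_iff zero_le_numeral simp_thms)
  then show "ennreal (2 * real M) * (\<integral>\<^sup>+s. \<integral>\<^sup>+r. pair_kernel s r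
        * ennreal (empirical_survival (2*M) z s + empirical_survival (2*M) z r - 1) \<partial>lborel \<partial>lborel)
    = (\<integral>\<^sup>+s. \<integral>\<^sup>+r. pair_kernel s r
        * ennreal (2 * real M * (empirical_survival (2*M) z s + empirical_survival (2*M) z r - 1)) \<partial>lborel \<partial>lborel)"
    by (simp only: nn_integral_cmult[symmetric] borel_measurable_overlap_section borel_measurable_overlap_integral
        borel_measurable_empirical_survival)
qed

lemma ennreal_mult_cancel_pos:
  assumes "0 < c"
  shows "ennreal c * x \<le> ennreal c * y \<longleftrightarrow> x \<le> y" "ennreal c * x = ennreal c * y \<longleftrightarrow> x = y"
  using assms by (auto simp: ennreal_mult_le_mult_iff ennreal_mult_cancel_left)

lemma two_sum_ln_rate:
  assumes "1 \<le> M"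
  shows "2 * ennreal (sum_ln_rate M z l) = ennreal (2 * real M) * ennreal (sum_ln_rate M z l / real M)"
proof -
  have "ennreal (2 * real M) * ennreal (sum_ln_rate M z l / real M) = ennreal (2 * real M * (sum_ln_rate M z l / real M))"
    by (rule ennreal_mult'[symmetric]) simp
  also have "\<dots> = ennreal (2 * sum_ln_rate M z l)"
    using assms by simp
  also have "\<dots> = 2 * ennreal (sum_ln_rate M z l)"
    by (subst ennreal_mult') simp_all
  finally show ?thesis ..
qed

text \<open>In the identity for \<open>sum_ln_rate\<close>, the overlap is replaced by its Frechet
  lower bound, which is the same for all pairings; the common factor \<open>2 * M\<close> is then
  cancelled.\<close>

lemma sum_ln_rate_upper:
  assumes "1 \<le> M" "pairing M l" "\<And>i. i \<in> {1..2*M} \<Longrightarrow> 0 \<le> z i"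
  shows "ennreal (sum_ln_rate M z l / real M) + overlap_integral (empirical_survival (2*M) z)
    \<le> 2 * (\<integral>\<^sup>+s. ennreal (empirical_survival (2*M) z s) \<partial>log_measure UNIV)"
proof -
  have "ennreal (2 * real M) * (ennreal (sum_ln_rate M z l / real M) + overlap_integral (empirical_survival (2*M) z))
    \<le> 2 * ennreal (sum_ln_rate M z l)
      + (\<integral>\<^sup>+s. \<integral>\<^sup>+r. pair_kernel s r * ennreal (pair_overlap M z l s r) \<partial>lborel \<partial>lborel)"
    unfolding distrib_left overlap_integral_scaled two_sum_ln_rate[OF assms(1)]
    by (intro add_mono order_refl nn_integral_mono mult_left_mono ennreal_leI pair_overlap_ge assms) simp
  also have "\<dots> = ennreal (2 * real M) * (2 * (\<integral>\<^sup>+s. ennreal (empirical_survival (2*M) z s) \<partial>log_measure UNIV))"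
    using assms by (subst sum_ln_rate_identity) (auto simp: ac_simps)
  finally show ?thesis
    using assms(1) by (subst (asm) ennreal_mult_cancel_pos) auto
qed

lemma antimonotone_pairing_exists:
  fixes z :: "nat \<Rightarrow> real"
  obtains l where "pairing M l"
    "\<And>m k. m \<in> {1..M} \<Longrightarrow> k \<in> {1..M} \<Longrightarrow>
       \<not> (z (l (2*m-1)) < z (l (2*k-1)) \<and> z (l (2*m)) < z (l (2*k)))"
    "\<And>m k. m \<in> {1..M} \<Longrightarrow> k \<in> {1..M} \<Longrightarrow>
       \<not> (z (l (2*m-1)) < z (l (2*k)) \<and> z (l (2*m)) < z (l (2*k-1)))"
proof
  define xs where "xs = sort_key z [1..<2*M+1]"
  \<comment> \<open>With the users sorted by \<open>z\<close>, pair \<open>m\<close> consists of the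
    ranks \<open>m - 1\<close> and \<open>2 * M - m\<close>, counted from 0. Odd positions thus run
    up the lower half and even positions run down the upper half.\<close>
  define p where "p k = (if odd k then k div 2 else 2*M - k div 2)" for k :: nat
  define l where "l k = xs ! p k" for k
  have len: "length xs = 2*M" and set: "set xs = {1..2*M}" and dist: "distinct xs"
    and srt: "sorted (map z xs)"
    by (auto simp: xs_def)
  have mono: "z (xs ! i) \<le> z (xs ! j)" if "i \<le> j" "j < 2*M" for i j
    using sorted_nth_mono[OF srt, of i j] that len by simp
  have "inj_on p {1..2*M}"
  proof (rule inj_onI)
    fix i j assume "i \<in> {1..2*M}" "j \<in> {1..2*M}" "p i = p j"
    then show "i = j" unfolding p_def by (auto split: if_splits elim!: oddE evenE)
  qed
  moreover have "p ` {1..2*M} \<subseteq> {..<2*M}"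
    unfolding p_def by (auto elim!: oddE)
  ultimately have "bij_betw p {1..2*M} {..<2*M}"
    by (simp add: bij_betw_def card_subset_eq card_image)
  moreover have "bij_betw ((!) xs) {..<2*M} {1..2*M}"
    using bij_betw_nth[OF dist] len set by simp
  ultimately have "bij_betw l {1..2*M} {1..2*M}"
    using bij_betw_trans[of p _ _ "(!) xs"] by (simp add: l_def[abs_def] comp_def)
  then show "pairing M l" by (simp add: pairing_iff_bij_betw)
  have p1: "p (2*m-1) = m - 1" "p (2*m) = 2*M - m" if "m \<in> {1..M}" for m
    using that by (auto simp: p_def)
  show "\<not> (z (l (2*m-1)) < z (l (2*k-1)) \<and> z (l (2*m)) < z (l (2*k)))"
    if "m \<in> {1..M}" "k \<in> {1..M}" for m k
  proof (cases "m \<le> k")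
    case True
    then have "z (l (2*k)) \<le> z (l (2*m))"
      using that by (auto simp: l_def p1 intro!: mono)
    then show ?thesis by simp
  next
    case False
    then have "z (l (2*k-1)) \<le> z (l (2*m-1))"
      using that unfolding l_def p1[OF that(1)] p1[OF that(2)] by (intro mono) auto
    then show ?thesis by simp
  qed
  \<comment> \<open>In the crossed comparison no case split is needed: first entries lie in the
    lower half and second entries in the upper half.\<close>
  show "\<not> (z (l (2*m-1)) < z (l (2*k)) \<and> z (l (2*m)) < z (l (2*k-1)))"
    if "m \<in> {1..M}" "k \<in> {1..M}" for m k
  proof -
    have "z (l (2*k-1)) \<le> z (l (2*m))"
      using that unfolding l_def p1[OF that(1)] p1[OF that(2)] by (intro mono) auto
    then show ?thesis by simp
  qed
qed

text \<open>In a single pair the Frechet bound is an equality as soon as one of the two events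
  occurs. If some pair \<open>k\<close> straddles both thresholds, a pair in which neither occurs
  would be strictly below \<open>k\<close> in both entries, which antimonotonicity forbids. If no
  pair does so, the overlap is 0 and the Frechet expression is at most 0, so both sides vanish in
  \<open>ennreal\<close>.\<close>

lemma pair_overlap_antimonotone:
  assumes l: "pairing M l"
    and anti: "\<And>m k. m \<in> {1..M} \<Longrightarrow> k \<in> {1..M} \<Longrightarrow>
       \<not> (z (l (2*m-1)) < z (l (2*k-1)) \<and> z (l (2*m)) < z (l (2*k)))"
    "\<And>m k. m \<in> {1..M} \<Longrightarrow> k \<in> {1..M} \<Longrightarrow>
       \<not> (z (l (2*m-1)) < z (l (2*k)) \<and> z (l (2*m)) < z (l (2*k-1)))"
  shows "ennreal (pair_overlap M z l s r)
    = ennreal (2 * real M * (empirical_survival (2*M) z s + empirical_survival (2*M) z r - 1))"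
proof (cases "\<exists>m\<in>{1..M}. s < z (l (2*m-1)) \<and> r < z (l (2*m)) \<or> s < z (l (2*m)) \<and> r < z (l (2*m-1))")
  case True
  then obtain k where k: "k \<in> {1..M}"
    "s < z (l (2*k-1)) \<and> r < z (l (2*k)) \<or> s < z (l (2*k)) \<and> r < z (l (2*k-1))" by blast
  have *: "s < z (l (2*m-1)) \<or> r < z (l (2*m))" "s < z (l (2*m)) \<or> r < z (l (2*m-1))"
    if "m \<in> {1..M}" for m
    using anti(1)[OF that k(1)] anti(2)[OF that k(1)] k(2) by linarith+
  have "2 * real M * (empirical_survival (2*M) z s + empirical_survival (2*M) z r - 1)
    = (\<Sum>m=1..M. (of_bool (s < z (l (2*m-1))) + of_bool (s < z (l (2*m))))
        + (of_bool (r < z (l (2*m-1))) + of_bool (r < z (l (2*m)))) - 2)"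
    by (rule scaled_survival_sum[OF l])
  also have "\<dots> = pair_overlap M z l s r"
    unfolding pair_overlap_def
  proof (rule sum.cong)
    fix m assume "m \<in> {1..M}"
    from *[OF this] show "of_bool (s < z (l (2*m-1))) + of_bool (s < z (l (2*m)))
        + (of_bool (r < z (l (2*m-1))) + of_bool (r < z (l (2*m)))) - 2
      = (of_bool (s < z (l (2*m-1)) \<and> r < z (l (2*m))) + of_bool (s < z (l (2*m)) \<and> r < z (l (2*m-1))) :: real)"
      by auto
  qed simp
  finally show ?thesis by simp
next
  case False
  then have "pair_overlap M z l s r = 0"
    unfolding pair_overlap_def by (intro sum.neutral) auto
  with pair_overlap_ge[OF l, of z s r] show ?thesis by (simp add: ennreal_neg)
qed

text \<open>The given optimal pairing need not be the antimonotone one. Only its value is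
  identified: it obeys the bound valid for every pairing, and it is at least the value of the
  antimonotone pairing, which attains that bound.\<close>

lemma sum_ln_rate_optimal:
  assumes M: "1 \<le> M" and l: "pairing M l" and z: "\<And>i. i \<in> {1..2*M} \<Longrightarrow> 0 \<le> z i"
    and opt: "\<And>l'. pairing M l' \<Longrightarrow> sum_ln_rate M z l' \<le> sum_ln_rate M z l"
  shows "ennreal (sum_ln_rate M z l / real M) + overlap_integral (empirical_survival (2*M) z)
    = 2 * (\<integral>\<^sup>+s. ennreal (empirical_survival (2*M) z s) \<partial>log_measure UNIV)"
proof (rule antisym)
  show "ennreal (sum_ln_rate M z l / real M) + overlap_integral (empirical_survival (2*M) z)
    \<le> 2 * (\<integral>\<^sup>+s. ennreal (empirical_survival (2*M) z s) \<partial>log_measure UNIV)"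
    by (intro sum_ln_rate_upper M l z)
next
  obtain l' where l': "pairing M l'"
    and anti: "\<And>m k. m \<in> {1..M} \<Longrightarrow> k \<in> {1..M} \<Longrightarrow>
       \<not> (z (l' (2*m-1)) < z (l' (2*k-1)) \<and> z (l' (2*m)) < z (l' (2*k)))"
    "\<And>m k. m \<in> {1..M} \<Longrightarrow> k \<in> {1..M} \<Longrightarrow>
       \<not> (z (l' (2*m-1)) < z (l' (2*k)) \<and> z (l' (2*m)) < z (l' (2*k-1)))"
    using antimonotone_pairing_exists[of M z] by metis
  have "ennreal (2 * real M) * (2 * (\<integral>\<^sup>+s. ennreal (empirical_survival (2*M) z s) \<partial>log_measure UNIV))
    = 2 * ennreal (sum_ln_rate M z l')
      + (\<integral>\<^sup>+s. \<integral>\<^sup>+r. pair_kernel s r * ennreal (pair_overlap M z l' s r) \<partial>lborel \<partial>lborel)"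
    using z l' by (subst sum_ln_rate_identity) (auto simp: ac_simps)
  also have "\<dots> = ennreal (2 * real M) * (ennreal (sum_ln_rate M z l' / real M) + overlap_integral (empirical_survival (2*M) z))"
    by (simp only: distrib_left overlap_integral_scaled two_sum_ln_rate[OF M]
      pair_overlap_antimonotone[OF l' anti])
  finally have "2 * (\<integral>\<^sup>+s. ennreal (empirical_survival (2*M) z s) \<partial>log_measure UNIV)
    = ennreal (sum_ln_rate M z l' / real M) + overlap_integral (empirical_survival (2*M) z)"
    using M by (subst (asm) ennreal_mult_cancel_pos) auto
  also have "\<dots> \<le> ennreal (sum_ln_rate M z l / real M) + overlap_integral (empirical_survival (2*M) z)"
    using opt[OF l'] by (intro add_mono ennreal_leI divide_right_mono) auto
  finally show "2 * (\<integral>\<^sup>+s. ennreal (empirical_survival (2*M) z s) \<partial>log_measure UNIV)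
    \<le> ennreal (sum_ln_rate M z l / real M) + overlap_integral (empirical_survival (2*M) z)" .
qed

section \<open>The power of a complex Gaussian\<close>

lemma emeasure_annulus:
  assumes "0 \<le> s" "s \<le> t"
  shows "emeasure lborel {p :: real \<times> real. s < (norm p)\<^sup>2 \<and> (norm p)\<^sup>2 \<le> t} = ennreal (pi * (t - s))"
proof -
  have eq: "{p :: real \<times> real. s < (norm p)\<^sup>2 \<and> (norm p)\<^sup>2 \<le> t} = cball 0 (sqrt t) - cball 0 (sqrt s)"
  proof (intro set_eqI iffI)
    fix p :: "real \<times> real"
    have "(norm p)\<^sup>2 \<le> u \<longleftrightarrow> norm p \<le> sqrt u" if "0 \<le> u" for u
      using that real_le_rsqrt real_sqrt_le_iff by (metis norm_ge_zero power2_eq_square real_sqrt_abs2 abs_of_nonneg)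
    then have "s < (norm p)\<^sup>2 \<longleftrightarrow> sqrt s < norm p" "(norm p)\<^sup>2 \<le> t \<longleftrightarrow> norm p \<le> sqrt t"
      using assms by (auto simp: not_le[symmetric])
    then show "p \<in> {p. s < (norm p)\<^sup>2 \<and> (norm p)\<^sup>2 \<le> t} \<Longrightarrow> p \<in> cball 0 (sqrt t) - cball 0 (sqrt s)"
      and "p \<in> cball 0 (sqrt t) - cball 0 (sqrt s) \<Longrightarrow> p \<in> {p. s < (norm p)\<^sup>2 \<and> (norm p)\<^sup>2 \<le> t}"
      by auto
  qed
  have cball: "emeasure lborel (cball (0 :: real \<times> real) (sqrt u)) = ennreal (pi * u)" if "0 \<le> u" for u
    using that by (simp add: emeasure_cball unit_ball_vol_2)
  have "emeasure lborel (cball 0 (sqrt t) - cball (0 :: real \<times> real) (sqrt s))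
    = emeasure lborel (cball (0 :: real \<times> real) (sqrt t)) - emeasure lborel (cball (0 :: real \<times> real) (sqrt s))"
    using assms by (intro emeasure_Diff subset_cball) (simp_all add: cball)
  then show ?thesis
    using assms by (simp add: eq cball ennreal_minus algebra_simps)
qed

text \<open>The layer-cake formula for \<open>exp (- \<bar>p\<bar>\<^sup>2)\<close> turns the planar integral into areas of annuli.\<close>

lemma nn_integral_gauss_outside_disc:
  assumes s: "0 \<le> s"
  shows "(\<integral>\<^sup>+p. ennreal (exp (- (norm (p :: real \<times> real))\<^sup>2)) * indicator {p. s < (norm p)\<^sup>2} p \<partial>lborel)
    = ennreal (pi * exp (- s))"
proof -
  have layer: "ennreal (exp (- a)) = (\<integral>\<^sup>+t. ennreal (exp (- t)) * indicator {a..} t \<partial>lborel)" for a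
  proof -
    have "(\<integral>\<^sup>+t. ennreal (exp (- t)) * indicator {a..} t \<partial>lborel) = ennreal (0 - (- exp (- a)))"
    proof (rule nn_integral_FTC_atLeast)
      show "((\<lambda>t. - exp (- t)) \<longlongrightarrow> (0::real)) at_top"
        using tendsto_minus[OF filterlim_compose[OF exp_at_bot filterlim_uminus_at_bot_at_top]] by simp
    qed (auto intro!: derivative_eq_intros)
    then show ?thesis by simp
  qed
  have "(\<integral>\<^sup>+p. ennreal (exp (- (norm (p :: real \<times> real))\<^sup>2)) * indicator {p. s < (norm p)\<^sup>2} p \<partial>lborel)
    = (\<integral>\<^sup>+p. \<integral>\<^sup>+t. ennreal (exp (- t)) * (if s < (norm (p :: real \<times> real))\<^sup>2 \<and> (norm p)\<^sup>2 \<le> t then 1 else 0) \<partial>lborel \<partial>lborel)"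
    by (subst layer) (auto intro!: nn_integral_cong simp: indicator_def simp flip: nn_integral_multc)
  also have "\<dots> = (\<integral>\<^sup>+t. \<integral>\<^sup>+p. ennreal (exp (- t)) * (if s < (norm (p :: real \<times> real))\<^sup>2 \<and> (norm p)\<^sup>2 \<le> t then 1 else 0) \<partial>lborel \<partial>lborel)"
    by (rule lborel_pair.Fubini'[symmetric]) measurable
  also have "\<dots> = (\<integral>\<^sup>+t. ennreal (exp (- t) * (pi * (t - s))) * indicator {s..} t \<partial>lborel)"
  proof (intro nn_integral_cong)
    fix t
    have "(\<integral>\<^sup>+p. ennreal (exp (- t)) * (if s < (norm (p :: real \<times> real))\<^sup>2 \<and> (norm p)\<^sup>2 \<le> t then 1 else 0) \<partial>lborel)
      = ennreal (exp (- t)) * (\<integral>\<^sup>+p. indicator {p :: real \<times> real. s < (norm p)\<^sup>2 \<and> (norm p)\<^sup>2 \<le> t} p \<partial>lborel)"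
      by (subst nn_integral_cmult[symmetric]) (auto intro!: nn_integral_cong simp: indicator_def)
    also have "\<dots> = ennreal (exp (- t)) * emeasure lborel {p :: real \<times> real. s < (norm p)\<^sup>2 \<and> (norm p)\<^sup>2 \<le> t}"
      by simp
    also have "\<dots> = ennreal (exp (- t) * (pi * (t - s))) * indicator {s..} t"
    proof (cases "s \<le> t")
      case True
      then show ?thesis using s by (simp add: emeasure_annulus ennreal_mult')
    next
      case False
      then have "{p :: real \<times> real. s < (norm p)\<^sup>2 \<and> (norm p)\<^sup>2 \<le> t} = {}" by auto
      with False show ?thesis by (simp only: emeasure_empty) simp
    qed
    finally show "(\<integral>\<^sup>+p. ennreal (exp (- t)) * (if s < (norm (p :: real \<times> real))\<^sup>2 \<and> (norm p)\<^sup>2 \<le> t then 1 else 0) \<partial>lborel)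
      = ennreal (exp (- t) * (pi * (t - s))) * indicator {s..} t" .
  qed
  \<comment> \<open>Integration by parts gives the antiderivative
    \<open>- exp (- t) * (t - s + 1)\<close> of \<open>(t - s) * exp (- t)\<close>.\<close>
  also have "\<dots> = ennreal (0 - (- (pi * (exp (- s) * (s - s + 1)))))"
  proof (rule nn_integral_FTC_atLeast[where F = "\<lambda>t. - (pi * (exp (- t) * (t - s + 1)))"])
    show "((\<lambda>t. - (pi * (exp (- t) * (t - s + 1)))) \<longlongrightarrow> 0) at_top"
    proof -
      have "((\<lambda>t. - (pi * (t / exp t + (1 - s) * exp (- t)))) \<longlongrightarrow> - (pi * (0 + (1 - s) * 0))) at_top"
        using tendsto_power_div_exp_0[of 1] filterlim_compose[OF exp_at_bot filterlim_uminus_at_bot_at_top]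
        by (intro tendsto_intros) auto
      then show ?thesis by (simp add: exp_minus field_simps)
    qed
  qed (auto intro!: derivative_eq_intros simp: algebra_simps)
  finally show ?thesis by simp
qed

text \<open>With variance \<open>1/2\<close> in each component, the joint density is
  \<open>exp (- (norm p)\<^sup>2) / pi\<close>. The squared modulus is therefore exponential with
  mean 1.\<close>

lemma (in prob_space) std_complex_normal_power:
  assumes X: "std_complex_normal M X" and s: "0 \<le> s"
  shows "emeasure M {\<omega> \<in> space M. s < (cmod (X \<omega>))\<^sup>2} = ennreal (exp (- s))"
proof -
  have D: "distributed M (lborel \<Otimes>\<^sub>M lborel) (\<lambda>\<omega>. (Re (X \<omega>), Im (X \<omega>)))
      (\<lambda>(x, y). ennreal (normal_density 0 (sqrt (1/2)) x) * ennreal (normal_density 0 (sqrt (1/2)) y))"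
  proof (rule distributed_joint_indep)
    have "indep_var lborel ((\<lambda>x. x) \<circ> (\<lambda>\<omega>. Re (X \<omega>))) lborel ((\<lambda>x. x) \<circ> (\<lambda>\<omega>. Im (X \<omega>)))"
      by (rule indep_var_compose[of borel _ borel]) (use X in \<open>auto simp: std_complex_normal_def\<close>)
    then show "indep_var lborel (\<lambda>\<omega>. Re (X \<omega>)) lborel (\<lambda>\<omega>. Im (X \<omega>))"
      by (simp add: comp_def)
  qed (use X in \<open>auto simp: std_complex_normal_def sigma_finite_lborel\<close>)
  have nd: "ennreal (normal_density 0 (sqrt (1/2)) x) * ennreal (normal_density 0 (sqrt (1/2)) y)
      = ennreal (1 / pi) * ennreal (exp (- (norm (x, y))\<^sup>2))" for x y
    by (simp add: normal_density_def norm_Pair ennreal_mult'[symmetric] exp_add[symmetric] field_simps)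
  have "{\<omega> \<in> space M. s < (cmod (X \<omega>))\<^sup>2} = (\<lambda>\<omega>. (Re (X \<omega>), Im (X \<omega>))) -` {p. s < (norm p)\<^sup>2} \<inter> space M"
    by (auto simp: norm_Pair cmod_def)
  then have "emeasure M {\<omega> \<in> space M. s < (cmod (X \<omega>))\<^sup>2}
    = emeasure M ((\<lambda>\<omega>. (Re (X \<omega>), Im (X \<omega>))) -` {p. s < (norm p)\<^sup>2} \<inter> space M)" by simp
  also have "\<dots> = (\<integral>\<^sup>+p. (case p of (x, y) \<Rightarrow> ennreal (normal_density 0 (sqrt (1/2)) x) * ennreal (normal_density 0 (sqrt (1/2)) y))
      * indicator {p. s < (norm p)\<^sup>2} p \<partial>(lborel \<Otimes>\<^sub>M lborel))"
    by (rule distributed_emeasure[OF D], subst lborel_prod, simp)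
  also have "\<dots> = (\<integral>\<^sup>+p. ennreal (1 / pi) * (ennreal (exp (- (norm (p :: real \<times> real))\<^sup>2)) * indicator {p. s < (norm p)\<^sup>2} p) \<partial>lborel)"
    unfolding lborel_prod by (intro nn_integral_cong) (auto simp: nd ac_simps split: prod.splits)
  also have "\<dots> = ennreal (1 / pi) * ennreal (pi * exp (- s))"
    by (subst nn_integral_cmult) (simp_all add: nn_integral_gauss_outside_disc[OF s])
  also have "\<dots> = ennreal (exp (- s))"
    by (simp add: ennreal_mult'[symmetric])
  finally show ?thesis .
qed

section \<open>The distribution function and its inverse\<close>

text \<open>Clamping the argument at 0 gives the value 1 on the negative half-line, where the
  formula for \<open>cdf_F\<close> has no probabilistic meaning. The result is a measurable function
  on all reals with values in \<open>[0, 1]\<close>.\<close>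

definition survival :: "(real \<Rightarrow> real) \<Rightarrow> real \<Rightarrow> real" where
  "survival f s = 1 - cdf_F f (max 0 s)"

locale positive_density =
  fixes f :: "real \<Rightarrow> real"
  assumes nonneg: "0 \<le> f x"
    and zero: "x \<le> 0 \<Longrightarrow> f x = 0"
    and meas [measurable]: "f \<in> borel_measurable borel"
    and total: "(\<integral>\<^sup>+x. ennreal (f x) \<partial>lborel) = 1"
begin

lemma survival_eq: "survival f s = (LINT x|lborel. exp (- max 0 s / x) * f x)"
proof -
  have "indicator {0<..} x *\<^sub>R (exp (- max 0 s / x) * f x) = exp (- max 0 s / x) * f x" for x
    using zero[of x] by (cases "0 < x") auto
  then show ?thesis by (simp only: survival_def cdf_F_def set_lebesgue_integral_def)
qed

lemma integrable_density: "integrable lborel f"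
  by (rule integrableI_nonneg) (auto simp: nonneg total)

lemma integral_density: "(LINT x|lborel. f x) = 1"
  by (simp add: integral_eq_nn_integral nonneg total)

text \<open>The density is the majorant for all dominated convergence arguments below. For
  \<open>x \<le> 0\<close> the exponential may exceed 1, but there \<open>f\<close>
  vanishes.\<close>

lemma survival_integrand_le: "\<bar>exp (- max 0 s / x) * f x\<bar> \<le> f x"
proof (cases "0 < x")
  case True
  then have "exp (- max 0 s / x) \<le> 1" by simp
  then show ?thesis using nonneg[of x] by (simp add: abs_mult mult_left_le_one_le)
qed (simp add: zero)

lemma integrable_survival: "integrable lborel (\<lambda>x. exp (- max 0 s / x) * f x)"
  by (rule Bochner_Integration.integrable_bound[OF integrable_density])
    (use survival_integrand_le nonneg in auto)

lemma nn_integral_survival: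
  assumes "0 \<le> s"
  shows "(\<integral>\<^sup>+x. ennreal (f x) * ennreal (exp (- s / x)) \<partial>lborel) = ennreal (survival f s)"
proof -
  have "(\<integral>\<^sup>+x. ennreal (f x) * ennreal (exp (- s / x)) \<partial>lborel) = (\<integral>\<^sup>+x. ennreal (exp (- max 0 s / x) * f x) \<partial>lborel)"
    using assms by (intro nn_integral_cong) (simp add: ennreal_mult'[OF nonneg, symmetric] mult.commute max_def)
  also have "\<dots> = ennreal (survival f s)"
    unfolding survival_eq by (intro nn_integral_eq_integral integrable_survival) (simp add: nonneg)
  finally show ?thesis .
qed

lemma survival_nonneg: "0 \<le> survival f s"
  unfolding survival_eq by (intro Bochner_Integration.integral_nonneg) (simp add: nonneg)

lemma survival_0: "survival f 0 = 1"
  by (simp add: survival_eq integral_density)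

lemma survival_le_1: "survival f s \<le> 1"
  unfolding survival_eq integral_density[symmetric]
  by (intro integral_mono integrable_survival integrable_density) (use survival_integrand_le[of s] in \<open>auto simp: abs_le_iff\<close>)

text \<open>For each \<open>x > 0\<close> the factor \<open>exp (- s / x)\<close> strictly decreases
  in \<open>s\<close>. Equality of the integrals would force \<open>f = 0\<close> almost everywhere,
  against total mass 1.\<close>

lemma survival_strict_antimono:
  assumes "0 \<le> s" "s < t"
  shows "survival f t < survival f s"
proof -
  have "survival f s - survival f t = (LINT x|lborel. exp (- max 0 s / x) * f x - exp (- max 0 t / x) * f x)"
    unfolding survival_eq by (rule Bochner_Integration.integral_diff[symmetric]; rule integrable_survival)
  moreover have "(LINT x|lborel. exp (- max 0 s / x) * f x - exp (- max 0 t / x) * f x) > 0"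
  proof -
    have nonneg': "0 \<le> exp (- max 0 s / x) * f x - exp (- max 0 t / x) * f x" for x
    proof (cases "0 < x")
      case True
      then show ?thesis
        using assms nonneg[of x] by (auto intro!: mult_right_mono divide_right_mono)
    qed (simp add: zero)
    have "(LINT x|lborel. exp (- max 0 s / x) * f x - exp (- max 0 t / x) * f x) \<noteq> 0"
    proof
      assume "(LINT x|lborel. exp (- max 0 s / x) * f x - exp (- max 0 t / x) * f x) = 0"
      then have "AE x in lborel. exp (- max 0 s / x) * f x - exp (- max 0 t / x) * f x = 0"
        using integral_nonneg_eq_0_iff_AE[OF Bochner_Integration.integrable_diff[OF integrable_survival integrable_survival]
          AE_I2[OF nonneg']] by blast
      then have "AE x in lborel. f x = 0"
      proof eventually_elim
        case (elim x)
        show ?case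
        proof (cases "0 < x")
          case True
          then have "exp (- max 0 t / x) < exp (- max 0 s / x)"
            using assms by (simp add: divide_strict_right_mono)
          with elim show ?thesis by auto
        qed (simp add: zero)
      qed
      then have "(LINT x|lborel. f x) = 0"
        by (subst integral_cong_AE[of _ _ "\<lambda>_. 0"]) auto
      then show False by (simp add: integral_density)
    qed
    moreover have "0 \<le> (LINT x|lborel. exp (- max 0 s / x) * f x - exp (- max 0 t / x) * f x)"
      by (intro Bochner_Integration.integral_nonneg nonneg')
    ultimately show ?thesis by simp
  qed
  ultimately show ?thesis by simp
qed

lemma borel_measurable_survival [measurable]: "survival f \<in> borel_measurable borel"
  unfolding survival_eq[abs_def] by measurable

lemma continuous_survival: "continuous_on {0..} (survival f)"
  unfolding continuous_on_sequentially
proof safe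
  fix u :: "nat \<Rightarrow> real" and s
  assume u: "u \<longlonglongrightarrow> s"
  show "(survival f \<circ> u) \<longlonglongrightarrow> survival f s"
    unfolding comp_def survival_eq
  proof (rule integral_dominated_convergence[OF _ _ integrable_density])
    show "AE x in lborel. (\<lambda>n. exp (- max 0 (u n) / x) * f x) \<longlonglongrightarrow> exp (- max 0 s / x) * f x"
    proof (rule AE_I2)
      fix x
      show "(\<lambda>n. exp (- max 0 (u n) / x) * f x) \<longlonglongrightarrow> exp (- max 0 s / x) * f x"
        using u by (cases "x = 0") (auto simp: zero intro!: tendsto_intros tendsto_max)
    qed
  qed (use survival_integrand_le in auto)
qed

lemma survival_tendsto_0: "(\<lambda>n. survival f (real n)) \<longlonglongrightarrow> 0"
proof -
  have "(\<lambda>n. survival f (real n)) \<longlonglongrightarrow> (LINT x::real|lborel. 0)"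
    unfolding survival_eq
  proof (rule integral_dominated_convergence[OF _ _ integrable_density])
    show "AE x in lborel. (\<lambda>n. exp (- max 0 (real n) / x) * f x) \<longlonglongrightarrow> 0"
    proof (rule AE_I2)
      fix x
      show "(\<lambda>n. exp (- max 0 (real n) / x) * f x) \<longlonglongrightarrow> 0"
      proof (cases "0 < x")
        case True
        have "(\<lambda>n. exp (- (1 / x)) ^ n) \<longlonglongrightarrow> 0"
          using True by (intro LIMSEQ_power_zero) (simp only: real_norm_def abs_exp_cancel exp_less_one_iff, simp)
        then have "(\<lambda>n. exp (- (1 / x)) ^ n * f x) \<longlonglongrightarrow> 0 * f x"
          by (rule tendsto_mult_right)
        then show ?thesis by (simp add: exp_of_nat_mult[symmetric])
      qed (simp add: zero)
    qed
  qed (use survival_integrand_le[of "real _"] in auto)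
  then show ?thesis by simp
qed

lemma cdf_F_eq_survival: "0 \<le> s \<Longrightarrow> cdf_F f s = 1 - survival f s"
  by (simp add: survival_def)

text \<open>A value of \<open>inv_into\<close> is meaningful only on the image. The intermediate
  value theorem puts \<open>(0, 1)\<close> into it: the survival function is continuous, equals 1 at
  0 and tends to 0.\<close>

lemma inv_F:
  assumes "0 < t" "t < 1"
  shows "0 \<le> inv_F f t" "cdf_F f (inv_F f t) = t"
proof -
  have "\<forall>\<^sub>F n in sequentially. survival f (real n) < 1 - t"
    using order_tendstoD(2)[OF survival_tendsto_0, of "1 - t"] assms by simp
  then obtain n where n: "survival f (real n) < 1 - t"
    by (auto dest: eventually_happens)
  have "continuous_on {0..real n} (\<lambda>s. 1 - survival f s)"
    by (intro continuous_intros continuous_on_subset[OF continuous_survival]) auto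
  then obtain z where "0 \<le> z" "1 - survival f z = t"
    using IVT'[of "\<lambda>s. 1 - survival f s" 0 t "real n"] n assms by (auto simp: survival_0)
  then have t: "t \<in> cdf_F f ` {0..}"
    by (auto simp: cdf_F_eq_survival intro!: image_eqI[of _ _ z])
  show "0 \<le> inv_F f t" "cdf_F f (inv_F f t) = t"
    using inv_into_into[OF t] f_inv_into_f[OF t] by (simp_all add: inv_F_def)
qed

text \<open>Strict monotonicity turns superlevel sets of the quantile function into intervals. Apart
  from nonnegativity, this is all that is used about \<open>inv_F\<close> from here on.\<close>

lemma less_inv_F_iff:
  assumes t: "0 < t" "t < 1" and s: "0 \<le> s"
  shows "s < inv_F f t \<longleftrightarrow> 1 - survival f s < t"
proof -
  note Q = inv_F[OF t]
  have G: "survival f (inv_F f t) = 1 - t"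
    using Q by (simp add: cdf_F_eq_survival)
  show ?thesis
    using survival_strict_antimono[of s "inv_F f t"] survival_strict_antimono[of "inv_F f t" s] Q(1) s G
    by (cases s "inv_F f t" rule: linorder_cases) auto
qed

end

section \<open>Quantiles as random variables on the unit interval\<close>

context positive_density
begin

abbreviation "lower_quantile t \<equiv> inv_F f (t / 2)"
abbreviation "upper_quantile t \<equiv> inv_F f (1 - t / 2)"

definition rate_integral :: ennreal where
  "rate_integral = (\<integral>\<^sup>+t. ennreal (ln (1 + lower_quantile t + upper_quantile t)) \<partial>restrict_space lborel {0<..<1})"

lemma space_unit: "space (restrict_space lborel {0<..<1}) = {0<..<1::real}"
  by (simp add: space_restrict_space)

lemma sigma_finite_unit: "sigma_finite_measure (restrict_space lborel {0<..<1::real})"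
proof -
  interpret finite_measure "restrict_space lborel {0<..<1::real}"
    by (rule finite_measureI) (simp add: emeasure_restrict_space space_restrict_space)
  show ?thesis ..
qed

lemma quantile_nonneg:
  assumes "t \<in> {0<..<1}"
  shows "0 \<le> lower_quantile t" "0 \<le> upper_quantile t"
  using assms by (auto intro!: inv_F)

lemma less_quantile_iff:
  assumes "t \<in> {0<..<1}" "0 \<le> s"
  shows "s < lower_quantile t \<longleftrightarrow> 2 * (1 - survival f s) < t"
    "s < upper_quantile t \<longleftrightarrow> t < 2 * survival f s"
  using assms by (subst less_inv_F_iff; auto)+

text \<open>Outside \<open>(0, 1)\<close> the value of \<open>inv_into\<close> may be arbitrary, so
  measurability is claimed on the restricted space only. There the superlevel sets at
  \<open>s \<ge> 0\<close> are traces of half-lines, and those at \<open>s < 0\<close> are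
  everything.\<close>

lemma borel_measurable_quantile [measurable]:
  "lower_quantile \<in> borel_measurable (restrict_space lborel {0<..<1})"
  "upper_quantile \<in> borel_measurable (restrict_space lborel {0<..<1})"
proof -
  have *: "g \<in> borel_measurable (restrict_space lborel {0<..<1})"
    if nn: "\<And>t. t \<in> {0<..<1} \<Longrightarrow> 0 \<le> g t"
      and A: "\<And>s. 0 \<le> s \<Longrightarrow> \<exists>A\<in>sets borel. \<forall>t\<in>{0<..<1}. s < g t \<longleftrightarrow> t \<in> A" for g :: "real \<Rightarrow> real"
    unfolding borel_measurable_iff_greater
  proof
    fix s
    show "{t \<in> space (restrict_space lborel {0<..<1}). s < g t} \<in> sets (restrict_space lborel {0<..<1})"
    proof (cases "0 \<le> s")
      case True
      then obtain B where "B \<in> sets borel" "\<forall>t\<in>{0<..<1}. s < g t \<longleftrightarrow> t \<in> B"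
        using A by blast
      moreover from this have "{t \<in> space (restrict_space lborel {0<..<1}). s < g t} = {0<..<1} \<inter> B"
        by (auto simp: space_unit)
      ultimately show ?thesis by (auto simp: sets_restrict_space)
    next
      case False
      then have "s < g t" if "t \<in> {0<..<1}" for t
        using nn[OF that] by simp
      then have "{t \<in> space (restrict_space lborel {0<..<1}). s < g t} = space (restrict_space lborel {0<..<1})"
        unfolding space_unit by blast
      then show ?thesis by (simp only: sets.top)
    qed
  qed
  show "lower_quantile \<in> borel_measurable (restrict_space lborel {0<..<1})"
  proof (rule *)
    show "\<exists>A\<in>sets borel. \<forall>t\<in>{0<..<1}. s < lower_quantile t \<longleftrightarrow> t \<in> A" if "0 \<le> s" for s
      by (rule bexI[of _ "{2 * (1 - survival f s)<..}"]) (intro ballI, simp only: less_quantile_iff that greaterThan_iff, simp)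
  qed (rule quantile_nonneg)
  show "upper_quantile \<in> borel_measurable (restrict_space lborel {0<..<1})"
  proof (rule *)
    show "\<exists>A\<in>sets borel. \<forall>t\<in>{0<..<1}. s < upper_quantile t \<longleftrightarrow> t \<in> A" if "0 \<le> s" for s
      by (rule bexI[of _ "{..<2 * survival f s}"]) (intro ballI, simp only: less_quantile_iff that lessThan_iff, simp)
  qed (rule quantile_nonneg)
qed

lemma emeasure_unit_interval:
  assumes "0 \<le> a"
  shows "emeasure (restrict_space lborel {0<..<1}) {t \<in> {0<..<1}. a < t \<and> t < b} = ennreal (min 1 b - a)"
proof -
  have eq: "{t \<in> {0<..<1}. a < t \<and> t < b} = {a<..<min 1 b}"
    using assms by auto
  have sub: "{a<..<min 1 b} \<subseteq> {0<..<1}"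
    unfolding eq[symmetric] by blast
  have "emeasure (restrict_space lborel {0<..<1}) {a<..<min 1 b} = emeasure lborel {a<..<min 1 b}"
    by (rule emeasure_restrict_space[OF _ sub]) simp
  also have "\<dots> = ennreal (min 1 b - a)"
  proof (cases "a \<le> min 1 b")
    case True
    then show ?thesis by (rule emeasure_lborel_Ioo)
  next
    case False
    then have "{a<..<min 1 b} = {}" by auto
    then show ?thesis using ennreal_neg[of "min 1 b - a"] False by (simp only: emeasure_empty)
  qed
  finally show ?thesis unfolding eq .
qed

lemma emeasure_quantile:
  assumes s: "0 \<le> s" and r: "0 \<le> r"
  defines "\<mu> \<equiv> restrict_space lborel {0<..<1}"
  shows "emeasure \<mu> {t \<in> space \<mu>. s < lower_quantile t} = ennreal (2 * survival f s - 1)"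
    and "emeasure \<mu> {t \<in> space \<mu>. s < upper_quantile t} = ennreal (min 1 (2 * survival f s))"
    and "emeasure \<mu> {t \<in> space \<mu>. s < lower_quantile t \<and> r < upper_quantile t}
      = ennreal (min 1 (2 * survival f r) - 2 * (1 - survival f s))"
proof -
  have 1: "{t \<in> space \<mu>. s < lower_quantile t} = {t \<in> {0<..<1}. 2 * (1 - survival f s) < t \<and> t < 1}"
    and 2: "{t \<in> space \<mu>. s < upper_quantile t} = {t \<in> {0<..<1}. 0 < t \<and> t < 2 * survival f s}"
    and 3: "{t \<in> space \<mu>. s < lower_quantile t \<and> r < upper_quantile t}
      = {t \<in> {0<..<1}. 2 * (1 - survival f s) < t \<and> t < 2 * survival f r}"
    unfolding \<mu>_def space_unit by (auto simp only: less_quantile_iff s r mem_Collect_eq greaterThanLessThan_iff)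
  have *: "0 \<le> 2 * (1 - survival f s)" using survival_le_1[of s] by simp
  show "emeasure \<mu> {t \<in> space \<mu>. s < lower_quantile t} = ennreal (2 * survival f s - 1)"
    unfolding 1 unfolding \<mu>_def emeasure_unit_interval[OF *] by (simp add: algebra_simps)
  show "emeasure \<mu> {t \<in> space \<mu>. s < upper_quantile t} = ennreal (min 1 (2 * survival f s))"
    unfolding 2 unfolding \<mu>_def by (subst emeasure_unit_interval) simp_all
  show "emeasure \<mu> {t \<in> space \<mu>. s < lower_quantile t \<and> r < upper_quantile t}
      = ennreal (min 1 (2 * survival f r) - 2 * (1 - survival f s))"
    unfolding 3 unfolding \<mu>_def by (rule emeasure_unit_interval[OF *])
qed

text \<open>As \<open>t\<close> runs through \<open>(0, 1)\<close>, the points \<open>t / 2\<close>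
  and \<open>1 - t / 2\<close> together cover \<open>(0, 1)\<close> once up to a null set, each with
  density 2. The two marginals therefore add up to twice the law with distribution function
  \<open>F\<close>.\<close>

lemma quantile_survival_sum:
  assumes "0 \<le> s"
  defines "\<mu> \<equiv> restrict_space lborel {0<..<1}"
  shows "emeasure \<mu> {t \<in> space \<mu>. s < lower_quantile t} + emeasure \<mu> {t \<in> space \<mu>. s < upper_quantile t}
    = 2 * ennreal (survival f s)"
proof -
  have "ennreal (2 * survival f s - 1) + ennreal (min 1 (2 * survival f s))
    = ennreal (max 0 (2 * survival f s - 1) + min 1 (2 * survival f s))"
    using survival_nonneg[of s] by (subst ennreal_plus) (auto simp: max_def ennreal_neg)
  also have "max 0 (2 * survival f s - 1) + min 1 (2 * survival f s) = 2 * survival f s"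
    by (simp add: max_def min_def)
  finally have "ennreal (2 * survival f s - 1) + ennreal (min 1 (2 * survival f s)) = ennreal (2 * survival f s)" .
  also have "\<dots> = 2 * ennreal (survival f s)"
    by (subst ennreal_mult') simp_all
  finally show ?thesis
    unfolding \<mu>_def by (simp only: emeasure_quantile[OF assms(1) assms(1)])
qed

text \<open>The lower quantile increases and the upper one decreases in \<open>t\<close>, so each
  joint event is an interval. Adding both orders, a case split at \<open>1/2\<close> yields equality
  in the Frechet bound, just as for the antimonotone pairing.\<close>

lemma quantile_overlap_sum:
  assumes "0 \<le> s" "0 \<le> r"
  defines "\<mu> \<equiv> restrict_space lborel {0<..<1}"
  shows "emeasure \<mu> {t \<in> space \<mu>. s < lower_quantile t \<and> r < upper_quantile t}
      + emeasure \<mu> {t \<in> space \<mu>. r < lower_quantile t \<and> s < upper_quantile t}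
    = 2 * ennreal (survival f s + survival f r - 1)"
proof -
  have pos: "ennreal a = ennreal (max 0 a)" for a by (simp add: max_def ennreal_neg)
  have "ennreal (min 1 (2 * survival f r) - 2 * (1 - survival f s)) + ennreal (min 1 (2 * survival f s) - 2 * (1 - survival f r))
    = ennreal (max 0 (min 1 (2 * survival f r) - 2 * (1 - survival f s)) + max 0 (min 1 (2 * survival f s) - 2 * (1 - survival f r)))"
    by (subst ennreal_plus) (simp_all only: pos[symmetric] max.cobounded1)
  also have "max 0 (min 1 (2 * survival f r) - 2 * (1 - survival f s)) + max 0 (min 1 (2 * survival f s) - 2 * (1 - survival f r))
    = 2 * max 0 (survival f s + survival f r - 1)"
    using survival_nonneg[of s] survival_nonneg[of r] survival_le_1[of s] survival_le_1[of r]
    by (auto simp: min_def max_def)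
  also have "\<dots> = 2 * ennreal (survival f s + survival f r - 1)"
    by (subst ennreal_mult') (simp_all only: pos[symmetric] ennreal_numeral zero_le_numeral)
  finally show ?thesis
    unfolding \<mu>_def
    by (simp only: emeasure_quantile(3)[OF assms(1,2)] emeasure_quantile(3)[OF assms(2,1)])
qed

text \<open>The counterpart of \<open>sum_ln_rate_optimal\<close> for the limit law.
  \<open>nn_integral_ln_pair\<close> is used for the two quantiles in both orders, and the resulting
  factor 2 is cancelled.\<close>

lemma rate_integral_identity:
  "rate_integral + overlap_integral (survival f) = 2 * (\<integral>\<^sup>+s. ennreal (survival f s) \<partial>log_measure UNIV)"
proof -
  define \<mu> where "\<mu> = restrict_space lborel {0<..<1::real}"
  define E where "E U V s r = emeasure \<mu> {t \<in> space \<mu>. s < U t \<and> r < V t}" for U V :: "real \<Rightarrow> real" and s r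
  interpret \<mu>: sigma_finite_measure \<mu> unfolding \<mu>_def by (rule sigma_finite_unit)
  have [measurable]: "lower_quantile \<in> borel_measurable \<mu>" "upper_quantile \<in> borel_measurable \<mu>"
    by (simp_all add: \<mu>_def)
  have nn: "0 \<le> lower_quantile t" "0 \<le> upper_quantile t" if "t \<in> space \<mu>" for t
    using quantile_nonneg[of t] that by (simp_all add: \<mu>_def space_unit)
  have [measurable]: "(\<lambda>p. E U V (fst p) (snd p)) \<in> borel_measurable (borel \<Otimes>\<^sub>M borel)"
    if [measurable]: "U \<in> borel_measurable \<mu>" "V \<in> borel_measurable \<mu>" for U V
    unfolding E_def by measurable
  have one: "(\<integral>\<^sup>+t. ennreal (ln (1 + U t + V t)) \<partial>\<mu>) + (\<integral>\<^sup>+s. \<integral>\<^sup>+r. pair_kernel s r * E U V s r \<partial>lborel \<partial>lborel)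
      = (\<integral>\<^sup>+s. emeasure \<mu> {t \<in> space \<mu>. s < U t} + emeasure \<mu> {t \<in> space \<mu>. s < V t} \<partial>log_measure UNIV)"
    if "U \<in> borel_measurable \<mu>" "V \<in> borel_measurable \<mu>" "\<And>t. t \<in> space \<mu> \<Longrightarrow> 0 \<le> U t" "\<And>t. t \<in> space \<mu> \<Longrightarrow> 0 \<le> V t"
    for U V
    unfolding E_def by (rule nn_integral_ln_pair) (use that \<mu>.sigma_finite_measure_axioms in auto)
  have sum: "(\<integral>\<^sup>+s. emeasure \<mu> {t \<in> space \<mu>. s < lower_quantile t} + emeasure \<mu> {t \<in> space \<mu>. s < upper_quantile t} \<partial>log_measure UNIV)
      = 2 * (\<integral>\<^sup>+s. ennreal (survival f s) \<partial>log_measure UNIV)"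
    by (subst nn_integral_cmult[symmetric], simp, rule nn_integral_log_measure_cong)
      (simp, simp only: quantile_survival_sum \<mu>_def)
  have ov: "(\<integral>\<^sup>+s. \<integral>\<^sup>+r. pair_kernel s r * E lower_quantile upper_quantile s r \<partial>lborel \<partial>lborel)
      + (\<integral>\<^sup>+s. \<integral>\<^sup>+r. pair_kernel s r * E upper_quantile lower_quantile s r \<partial>lborel \<partial>lborel)
    = 2 * overlap_integral (survival f)"
  proof -
    have "(\<integral>\<^sup>+s. \<integral>\<^sup>+r. pair_kernel s r * E lower_quantile upper_quantile s r \<partial>lborel \<partial>lborel)
        + (\<integral>\<^sup>+s. \<integral>\<^sup>+r. pair_kernel s r * E upper_quantile lower_quantile s r \<partial>lborel \<partial>lborel)
      = (\<integral>\<^sup>+s. \<integral>\<^sup>+r. pair_kernel s r * (E lower_quantile upper_quantile s r + E upper_quantile lower_quantile s r) \<partial>lborel \<partial>lborel)"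
      unfolding E_def by (simp add: distrib_left nn_integral_add)
    also have "\<dots> = (\<integral>\<^sup>+s. \<integral>\<^sup>+r. 2 * (pair_kernel s r * ennreal (survival f s + survival f r - 1)) \<partial>lborel \<partial>lborel)"
    proof (intro nn_integral_cong)
      fix s r
      show "pair_kernel s r * (E lower_quantile upper_quantile s r + E upper_quantile lower_quantile s r)
        = 2 * (pair_kernel s r * ennreal (survival f s + survival f r - 1))"
      proof (cases "0 \<le> s \<and> 0 \<le> r")
        case True
        have "E upper_quantile lower_quantile s r = emeasure \<mu> {t \<in> space \<mu>. r < lower_quantile t \<and> s < upper_quantile t}"
          unfolding E_def by (rule arg_cong[where f="emeasure \<mu>"]) auto
        then have "E lower_quantile upper_quantile s r + E upper_quantile lower_quantile s r
          = 2 * ennreal (survival f s + survival f r - 1)"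
          using quantile_overlap_sum[of s r] True by (simp add: E_def \<mu>_def)
        then show ?thesis by (simp only: mult.left_commute)
      qed (auto simp: pair_kernel_def)
    qed
    also have "\<dots> = 2 * overlap_integral (survival f)"
      unfolding overlap_integral_def by (simp add: nn_integral_cmult)
    finally show ?thesis .
  qed
  have L: "(\<integral>\<^sup>+t. ennreal (ln (1 + lower_quantile t + upper_quantile t)) \<partial>\<mu>) = rate_integral"
    "(\<integral>\<^sup>+t. ennreal (ln (1 + upper_quantile t + lower_quantile t)) \<partial>\<mu>) = rate_integral"
    by (simp_all add: rate_integral_def \<mu>_def algebra_simps)
  have "2 * (rate_integral + overlap_integral (survival f)) = 2 * (2 * (\<integral>\<^sup>+s. ennreal (survival f s) \<partial>log_measure UNIV))"
  proof -
    have "2 * (rate_integral + overlap_integral (survival f))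
      = (rate_integral + (\<integral>\<^sup>+s. \<integral>\<^sup>+r. pair_kernel s r * E lower_quantile upper_quantile s r \<partial>lborel \<partial>lborel))
      + (rate_integral + (\<integral>\<^sup>+s. \<integral>\<^sup>+r. pair_kernel s r * E upper_quantile lower_quantile s r \<partial>lborel \<partial>lborel))"
      unfolding distrib_left ov[symmetric] by (simp add: mult_2 mult_2_right ac_simps)
    also have "\<dots> = 2 * (\<integral>\<^sup>+s. ennreal (survival f s) \<partial>log_measure UNIV)
        + 2 * (\<integral>\<^sup>+s. ennreal (survival f s) \<partial>log_measure UNIV)"
    proof -
      have sum': "(\<integral>\<^sup>+s. emeasure \<mu> {t \<in> space \<mu>. s < upper_quantile t} + emeasure \<mu> {t \<in> space \<mu>. s < lower_quantile t} \<partial>log_measure UNIV)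
          = 2 * (\<integral>\<^sup>+s. ennreal (survival f s) \<partial>log_measure UNIV)"
        unfolding sum[symmetric] by (intro nn_integral_cong) (rule add.commute)
      show ?thesis
        using one[of lower_quantile upper_quantile, unfolded sum L] one[of upper_quantile lower_quantile, unfolded sum' L]
        by (simp only: nn \<open>lower_quantile \<in> borel_measurable \<mu>\<close> \<open>upper_quantile \<in> borel_measurable \<mu>\<close>)
    qed
    finally show ?thesis by (simp add: mult_2)
  qed
  then show ?thesis
    unfolding ennreal_numeral[symmetric] by (rule ennreal_mult_cancel_pos(2)[THEN iffD1, rotated]) simp
qed

text \<open>This transfers finiteness from the limit rate to the survival integral.
  \<open>rate_integral_identity\<close> cannot be solved for it before the overlap is known to be
  finite, so the argument goes through the pointwise bound \<open>ln_pair_ge\<close>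
  instead.\<close>

lemma survival_integral_le_rate_integral:
  "(\<integral>\<^sup>+s. ennreal (survival f s) \<partial>log_measure UNIV) \<le> rate_integral"
proof -
  define \<mu> where "\<mu> = restrict_space lborel {0<..<1::real}"
  interpret \<mu>: sigma_finite_measure \<mu> unfolding \<mu>_def by (rule sigma_finite_unit)
  have [measurable]: "lower_quantile \<in> borel_measurable \<mu>" "upper_quantile \<in> borel_measurable \<mu>"
    by (simp_all add: \<mu>_def)
  have nn: "0 \<le> lower_quantile t" "0 \<le> upper_quantile t" if "t \<in> space \<mu>" for t
    using quantile_nonneg[of t] that by (simp_all add: \<mu>_def space_unit)
  have one: "(\<integral>\<^sup>+s. emeasure \<mu> {t \<in> space \<mu>. s < U t} \<partial>log_measure UNIV) = (\<integral>\<^sup>+t. ennreal (ln (1 + U t)) \<partial>\<mu>)"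
    if [measurable]: "U \<in> borel_measurable \<mu>" and "\<And>t. t \<in> space \<mu> \<Longrightarrow> 0 \<le> U t" for U
  proof -
    \<comment> \<open>Taking the second variable to be 0 kills the overlap and leaves the layer-cake
      formula for a single variable.\<close>
    have "(\<integral>\<^sup>+t. ennreal (ln (1 + U t + 0)) \<partial>\<mu>)
        + (\<integral>\<^sup>+s. \<integral>\<^sup>+r. pair_kernel s r * emeasure \<mu> {t \<in> space \<mu>. s < U t \<and> r < 0} \<partial>lborel \<partial>lborel)
      = (\<integral>\<^sup>+s. emeasure \<mu> {t \<in> space \<mu>. s < U t} + emeasure \<mu> {t \<in> space \<mu>. s < 0} \<partial>log_measure UNIV)"
      by (rule nn_integral_ln_pair) (use that \<mu>.sigma_finite_measure_axioms in auto)
    moreover have "pair_kernel s r * emeasure \<mu> {t \<in> space \<mu>. s < U t \<and> r < 0} = 0" for s r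
      by (cases "r < 0") (simp_all add: pair_kernel_def)
    moreover have "(\<integral>\<^sup>+s. emeasure \<mu> {t \<in> space \<mu>. s < U t} + emeasure \<mu> {t \<in> space \<mu>. s < 0} \<partial>log_measure UNIV)
      = (\<integral>\<^sup>+s. emeasure \<mu> {t \<in> space \<mu>. s < U t} \<partial>log_measure UNIV)"
      by (rule nn_integral_log_measure_cong) auto
    ultimately show ?thesis by simp
  qed
  have "2 * (\<integral>\<^sup>+s. ennreal (survival f s) \<partial>log_measure UNIV)
    = (\<integral>\<^sup>+s. emeasure \<mu> {t \<in> space \<mu>. s < lower_quantile t} + emeasure \<mu> {t \<in> space \<mu>. s < upper_quantile t} \<partial>log_measure UNIV)"
    by (subst nn_integral_cmult[symmetric], simp, rule nn_integral_log_measure_cong)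
      (simp, simp only: quantile_survival_sum \<mu>_def)
  also have "\<dots> = (\<integral>\<^sup>+s. emeasure \<mu> {t \<in> space \<mu>. s < lower_quantile t} \<partial>log_measure UNIV)
      + (\<integral>\<^sup>+s. emeasure \<mu> {t \<in> space \<mu>. s < upper_quantile t} \<partial>log_measure UNIV)"
    by (rule nn_integral_add) measurable
  also have "\<dots> = (\<integral>\<^sup>+t. ennreal (ln (1 + lower_quantile t)) + ennreal (ln (1 + upper_quantile t)) \<partial>\<mu>)"
    by (subst (1 2) one) (simp_all add: nn nn_integral_add)
  also have "\<dots> \<le> (\<integral>\<^sup>+t. 2 * ennreal (ln (1 + lower_quantile t + upper_quantile t)) \<partial>\<mu>)"
  proof (intro nn_integral_mono)
    fix t assume t: "t \<in> space \<mu>"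
    have "ennreal (ln (1 + lower_quantile t)) + ennreal (ln (1 + upper_quantile t))
      \<le> ennreal (2 * ln (1 + lower_quantile t + upper_quantile t))"
      using ennreal_leI[OF ln_pair_ge[OF nn[OF t]]] nn[OF t] by (simp add: ennreal_plus)
    also have "\<dots> = 2 * ennreal (ln (1 + lower_quantile t + upper_quantile t))"
      by (subst ennreal_mult') simp_all
    finally show "ennreal (ln (1 + lower_quantile t)) + ennreal (ln (1 + upper_quantile t))
      \<le> 2 * ennreal (ln (1 + lower_quantile t + upper_quantile t))" .
  qed
  also have "\<dots> = 2 * rate_integral"
    unfolding rate_integral_def \<mu>_def[symmetric] by (rule nn_integral_cmult) measurable
  finally show ?thesis by (simp add: ennreal_mult_le_mult_iff)
qed

lemma limit_rate_eq: "limit_rate f = ennreal (1 / (2 * ln 2)) * rate_integral"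
proof -
  have "limit_rate f = (\<integral>\<^sup>+t. ennreal (1/2 * log 2 (1 + lower_quantile t + upper_quantile t)) \<partial>restrict_space lborel {0<..<1})"
    unfolding limit_rate_def by (subst nn_integral_restrict_space) simp_all
  also have "\<dots> = (\<integral>\<^sup>+t. ennreal (1 / (2 * ln 2)) * ennreal (ln (1 + lower_quantile t + upper_quantile t)) \<partial>restrict_space lborel {0<..<1})"
    by (intro nn_integral_cong, subst ennreal_mult'[symmetric]) (simp_all add: log_def)
  also have "\<dots> = ennreal (1 / (2 * ln 2)) * rate_integral"
    unfolding rate_integral_def by (rule nn_integral_cmult) measurable
  finally show ?thesis .
qed

end

section \<open>Concentration of the empirical survival function\<close>

text \<open>Independence of the generated sigma-algebras makes the joint law a product, as it
  suffices to check rectangles. Tonelli then allows integrating over \<open>X\<close> with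
  \<open>Y\<close> frozen.\<close>

lemma (in prob_space) nn_integral_indep_rv:
  assumes indep: "indep_rv M S X T Y"
    and [measurable]: "X \<in> M \<rightarrow>\<^sub>M S" "Y \<in> M \<rightarrow>\<^sub>M T" "g \<in> borel_measurable (S \<Otimes>\<^sub>M T)"
  shows "(\<integral>\<^sup>+\<omega>. g (X \<omega>, Y \<omega>) \<partial>M) = (\<integral>\<^sup>+\<omega>'. \<integral>\<^sup>+\<omega>. g (X \<omega>, Y \<omega>') \<partial>M \<partial>M)"
proof -
  interpret X: prob_space "distr M S X" by (rule prob_space_distr) measurable
  interpret Y: prob_space "distr M T Y" by (rule prob_space_distr) measurable
  have eq: "distr M S X \<Otimes>\<^sub>M distr M T Y = distr M (S \<Otimes>\<^sub>M T) (\<lambda>\<omega>. (X \<omega>, Y \<omega>))"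
  proof (rule pair_measure_eqI)
    fix A B assume "A \<in> sets (distr M S X)" "B \<in> sets (distr M T Y)"
    then have [measurable]: "A \<in> sets S" "B \<in> sets T" by simp_all
    have "prob ((X -` A \<inter> space M) \<inter> (Y -` B \<inter> space M)) = prob (X -` A \<inter> space M) * prob (Y -` B \<inter> space M)"
      using indep unfolding indep_rv_def by (rule indep_setD) (auto intro!: in_vimage_algebra)
    moreover have "(X -` A \<inter> space M) \<inter> (Y -` B \<inter> space M) = (\<lambda>\<omega>. (X \<omega>, Y \<omega>)) -` (A \<times> B) \<inter> space M"
      by auto
    ultimately show "emeasure (distr M S X) A * emeasure (distr M T Y) B
        = emeasure (distr M (S \<Otimes>\<^sub>M T) (\<lambda>\<omega>. (X \<omega>, Y \<omega>))) (A \<times> B)"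
      by (simp add: emeasure_distr emeasure_eq_measure ennreal_mult')
  qed (auto intro: X.sigma_finite_measure_axioms Y.sigma_finite_measure_axioms)
  interpret XY: pair_prob_space "distr M S X" "distr M T Y" ..
  have "(\<integral>\<^sup>+\<omega>. g (X \<omega>, Y \<omega>) \<partial>M) = (\<integral>\<^sup>+p. g p \<partial>(distr M S X \<Otimes>\<^sub>M distr M T Y))"
    unfolding eq by (subst nn_integral_distr) auto
  also have "\<dots> = (\<integral>\<^sup>+y. \<integral>\<^sup>+x. g (x, y) \<partial>distr M S X \<partial>distr M T Y)"
    by (rule XY.nn_integral_snd[symmetric]) measurable
  also have "\<dots> = (\<integral>\<^sup>+\<omega>'. \<integral>\<^sup>+x. g (x, Y \<omega>') \<partial>distr M S X \<partial>M)"
    by (rule nn_integral_distr) measurable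
  also have "\<dots> = (\<integral>\<^sup>+\<omega>'. \<integral>\<^sup>+\<omega>. g (X \<omega>, Y \<omega>') \<partial>M \<partial>M)"
    by (intro nn_integral_cong, subst nn_integral_distr) (auto intro!: measurable_compose[OF _ assms(4)] measurable_Pair dest: measurable_space[OF assms(3)])
  finally show ?thesis .
qed

lemma (in prob_space) AE_positive_density:
  assumes f: "positive_density f" and Y: "distributed M lborel Y f"
  shows "AE \<omega> in M. 0 < Y \<omega>"
proof -
  have "AE x in lborel. 0 < ennreal (f x) \<longrightarrow> 0 < x"
    using positive_density.zero[OF f] by (intro AE_I2) (metis ennreal_0 less_irrefl not_le)
  then show ?thesis
    by (subst distributed_AE2[OF Y]) simp_all
qed

lemma prod_if_one_zero:
  "finite J \<Longrightarrow> (\<Prod>i\<in>J. if Q i then 1 else 0 :: ennreal) = (if \<forall>i\<in>J. Q i then 1 else 0)"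
  by (induction J rule: finite_induct) auto

text \<open>With the gains \<open>\<gamma> i\<close> frozen, independence of the \<open>h i\<close>
  and the exponential law of their squared moduli give a product of factors
  \<open>exp (- s / \<gamma> i)\<close>. Independence of the \<open>\<gamma> i\<close> then lets
  each factor be averaged to \<open>survival f s\<close>.\<close>

lemma (in prob_space) joint_survival:
  fixes h :: "nat \<Rightarrow> 'a \<Rightarrow> complex" and \<gamma> :: "nat \<Rightarrow> 'a \<Rightarrow> real"
  assumes f: "positive_density f" and J: "finite J" "J \<subseteq> I" and s: "0 \<le> s"
    and h: "\<And>i. i \<in> I \<Longrightarrow> std_complex_normal M (h i)" "indep_vars (\<lambda>_. borel) h I"
    and \<gamma>: "\<And>i. i \<in> I \<Longrightarrow> distributed M lborel (\<gamma> i) f" "indep_vars (\<lambda>_. borel) \<gamma> I"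
    and indep: "indep_rv M (\<Pi>\<^sub>M i\<in>I. borel) (\<lambda>\<omega>. \<lambda>i\<in>I. h i \<omega>) (\<Pi>\<^sub>M i\<in>I. borel) (\<lambda>\<omega>. \<lambda>i\<in>I. \<gamma> i \<omega>)"
  shows "emeasure M {\<omega> \<in> space M. \<forall>i\<in>J. s < \<gamma> i \<omega> * (cmod (h i \<omega>))\<^sup>2} = ennreal (survival f s ^ card J)"
proof -
  interpret positive_density f by fact
  have mh [measurable]: "h i \<in> borel_measurable M" if "i \<in> I" for i
    using h(2) that by (simp add: indep_vars_def)
  have mg [measurable]: "\<gamma> i \<in> borel_measurable M" if "i \<in> I" for i
    using \<gamma>(2) that by (simp add: indep_vars_def)
  have JI: "i \<in> I" if "i \<in> J" for i using J that by auto
  define b :: "real \<Rightarrow> complex \<Rightarrow> ennreal" where "b y x = (if s < y * (cmod x)\<^sup>2 then 1 else 0)" for y x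
  define g where "g = (\<lambda>(x, y). \<Prod>i\<in>J. b (y i) (x i))"
  have [measurable]: "g \<in> borel_measurable ((\<Pi>\<^sub>M i\<in>I. borel) \<Otimes>\<^sub>M (\<Pi>\<^sub>M i\<in>I. borel))"
    unfolding g_def b_def using JI by measurable
  have "emeasure M {\<omega> \<in> space M. \<forall>i\<in>J. s < \<gamma> i \<omega> * (cmod (h i \<omega>))\<^sup>2}
    = (\<integral>\<^sup>+\<omega>. indicator {\<omega> \<in> space M. \<forall>i\<in>J. s < \<gamma> i \<omega> * (cmod (h i \<omega>))\<^sup>2} \<omega> \<partial>M)"
    by (rule nn_integral_indicator[symmetric]) (use JI J in measurable)
  also have "\<dots> = (\<integral>\<^sup>+\<omega>. g (\<lambda>i\<in>I. h i \<omega>, \<lambda>i\<in>I. \<gamma> i \<omega>) \<partial>M)"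
  proof (intro nn_integral_cong)
    fix \<omega> assume "\<omega> \<in> space M"
    moreover have "g (\<lambda>i\<in>I. h i \<omega>, \<lambda>i\<in>I. \<gamma> i \<omega>) = (\<Prod>i\<in>J. if s < \<gamma> i \<omega> * (cmod (h i \<omega>))\<^sup>2 then 1 else 0)"
      unfolding g_def b_def using JI by (auto intro!: prod.cong)
    ultimately show "indicator {\<omega> \<in> space M. \<forall>i\<in>J. s < \<gamma> i \<omega> * (cmod (h i \<omega>))\<^sup>2} \<omega>
      = g (\<lambda>i\<in>I. h i \<omega>, \<lambda>i\<in>I. \<gamma> i \<omega>)"
      using J(1) by (simp add: prod_if_one_zero indicator_def)
  qed
  also have "\<dots> = (\<integral>\<^sup>+\<omega>'. \<integral>\<^sup>+\<omega>. g (\<lambda>i\<in>I. h i \<omega>, \<lambda>i\<in>I. \<gamma> i \<omega>') \<partial>M \<partial>M)"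
    by (rule nn_integral_indep_rv[OF indep]) (auto intro!: measurable_restrict)
  also have "\<dots> = (\<integral>\<^sup>+\<omega>'. (\<Prod>i\<in>J. ennreal (exp (- s / \<gamma> i \<omega>'))) \<partial>M)"
  proof (rule nn_integral_cong_AE)
    \<comment> \<open>Dividing the inequality by \<open>\<gamma> i\<close> requires positivity,
      which holds only almost surely.\<close>
    have "AE \<omega> in M. \<forall>i\<in>J. 0 < \<gamma> i \<omega>"
      by (intro AE_finite_allI J AE_positive_density[OF f] \<gamma>(1) JI)
    then show "AE \<omega>' in M. (\<integral>\<^sup>+\<omega>. g (\<lambda>i\<in>I. h i \<omega>, \<lambda>i\<in>I. \<gamma> i \<omega>') \<partial>M) = (\<Prod>i\<in>J. ennreal (exp (- s / \<gamma> i \<omega>')))"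
    proof eventually_elim
      case (elim \<omega>')
      have "(\<integral>\<^sup>+\<omega>. g (\<lambda>i\<in>I. h i \<omega>, \<lambda>i\<in>I. \<gamma> i \<omega>') \<partial>M) = (\<integral>\<^sup>+\<omega>. (\<Prod>i\<in>J. b (\<gamma> i \<omega>') (h i \<omega>)) \<partial>M)"
        unfolding g_def using JI by (auto intro!: nn_integral_cong prod.cong)
      also have "\<dots> = (\<Prod>i\<in>J. \<integral>\<^sup>+\<omega>. b (\<gamma> i \<omega>') (h i \<omega>) \<partial>M)"
      proof (rule indep_vars_nn_integral[OF J(1)])
        show "indep_vars (\<lambda>_. borel) (\<lambda>i \<omega>. b (\<gamma> i \<omega>') (h i \<omega>)) J"
          unfolding b_def by (rule indep_vars_compose2[OF indep_vars_subset[OF h(2) J(2)]]) measurable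
      qed simp
      also have "\<dots> = (\<Prod>i\<in>J. ennreal (exp (- s / \<gamma> i \<omega>')))"
      proof (rule prod.cong)
        fix i assume i: "i \<in> J"
        then have g: "0 < \<gamma> i \<omega>'" using elim by simp
        have [measurable]: "h i \<in> borel_measurable M" using mh[OF JI[OF i]] .
        have "(\<integral>\<^sup>+\<omega>. b (\<gamma> i \<omega>') (h i \<omega>) \<partial>M) = (\<integral>\<^sup>+\<omega>. indicator {\<omega> \<in> space M. s / \<gamma> i \<omega>' < (cmod (h i \<omega>))\<^sup>2} \<omega> \<partial>M)"
          using g by (intro nn_integral_cong) (auto simp: b_def indicator_def field_simps)
        also have "\<dots> = emeasure M {\<omega> \<in> space M. s / \<gamma> i \<omega>' < (cmod (h i \<omega>))\<^sup>2}"
          by (rule nn_integral_indicator) measurable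
        also have "\<dots> = ennreal (exp (- s / \<gamma> i \<omega>'))"
          using std_complex_normal_power[OF h(1)[OF JI[OF i]], of "s / \<gamma> i \<omega>'"] g s by simp
        finally show "(\<integral>\<^sup>+\<omega>. b (\<gamma> i \<omega>') (h i \<omega>) \<partial>M) = ennreal (exp (- s / \<gamma> i \<omega>'))" .
      qed simp
      finally show ?case .
    qed
  qed
  also have "\<dots> = (\<Prod>i\<in>J. \<integral>\<^sup>+\<omega>'. ennreal (exp (- s / \<gamma> i \<omega>')) \<partial>M)"
    by (rule indep_vars_nn_integral[OF J(1)])
      (auto intro: indep_vars_compose2[OF indep_vars_subset[OF \<gamma>(2) J(2)]])
  also have "\<dots> = (\<Prod>i\<in>J. ennreal (survival f s))"
  proof (rule prod.cong)
    fix i assume "i \<in> J"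
    then have "distributed M lborel (\<gamma> i) f" using \<gamma>(1) JI by blast
    from distributed_nn_integral[OF this, of "\<lambda>x. ennreal (exp (- s / x))"]
    show "(\<integral>\<^sup>+\<omega>'. ennreal (exp (- s / \<gamma> i \<omega>')) \<partial>M) = ennreal (survival f s)"
      by (simp add: nn_integral_survival[OF s, simplified])
  qed simp
  also have "\<dots> = ennreal (survival f s ^ card J)"
    by (simp add: ennreal_power survival_nonneg)
  finally show ?thesis .
qed

text \<open>The bound \<open>1 / sqrt n\<close> comes from the second moment: pairwise independence
  leaves only the diagonal, of total variance \<open>(p - p\<^sup>2) / n\<close>. The bound
  \<open>2 * p\<close> is the triangle inequality, both terms having mean \<open>p\<close>; it is
  the one that decays for large \<open>s\<close>.\<close>

lemma (in prob_space) empirical_survival_L1_le: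
  fixes z :: "nat \<Rightarrow> 'a \<Rightarrow> real"
  assumes n: "1 \<le> n" and z: "\<And>i. i \<in> {1..n} \<Longrightarrow> z i \<in> borel_measurable M"
    and one: "\<And>i. i \<in> {1..n} \<Longrightarrow> prob {\<omega> \<in> space M. s < z i \<omega>} = p"
    and two: "\<And>i j. i \<in> {1..n} \<Longrightarrow> j \<in> {1..n} \<Longrightarrow> i \<noteq> j \<Longrightarrow> prob {\<omega> \<in> space M. s < z i \<omega> \<and> s < z j \<omega>} = p\<^sup>2"
  shows "(\<integral>\<^sup>+\<omega>. ennreal \<bar>empirical_survival n (\<lambda>i. z i \<omega>) s - p\<bar> \<partial>M) \<le> ennreal (min (2 * p) (1 / sqrt (real n)))"
proof -
  have p: "0 \<le> p" "p \<le> 1" using one[of 1] n by (auto simp flip: one)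
  define B where "B i \<omega> = (if s < z i \<omega> then 1 else 0 :: real)" for i \<omega>
  have Bm [measurable]: "B i \<in> borel_measurable M" if "i \<in> {1..n}" for i
    unfolding B_def[abs_def] using z[OF that] by measurable
  have Bi: "integrable M (B i)" if "i \<in> {1..n}" for i
    by (rule integrable_const_bound[of _ 1]) (use that in \<open>auto simp: B_def intro: Bm[unfolded B_def]\<close>)
  have BBi: "integrable M (\<lambda>\<omega>. B i \<omega> * B j \<omega>)" if "i \<in> {1..n}" "j \<in> {1..n}" for i j
  proof (rule integrable_const_bound[of _ 1])
    show "(\<lambda>\<omega>. B i \<omega> * B j \<omega>) \<in> borel_measurable M"
      using Bm[OF that(1)] Bm[OF that(2)] by measurable
  qed (auto simp: B_def)
  have EB: "expectation (B i) = p" if i: "i \<in> {1..n}" for i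
  proof -
    have "expectation (B i) = expectation (indicator {\<omega> \<in> space M. s < z i \<omega>})"
      by (rule Bochner_Integration.integral_cong) (auto simp: B_def indicator_def)
    also have "\<dots> = p" using z[OF i] one[OF i] by simp
    finally show ?thesis .
  qed
  have EBB: "expectation (\<lambda>\<omega>. B i \<omega> * B j \<omega>) = (if i = j then p else p\<^sup>2)" if i: "i \<in> {1..n}" and j: "j \<in> {1..n}" for i j
  proof (cases "i = j")
    case True
    then have "expectation (\<lambda>\<omega>. B i \<omega> * B j \<omega>) = expectation (B i)"
      by (intro Bochner_Integration.integral_cong) (auto simp: B_def)
    with True show ?thesis using EB[OF i] by simp
  next
    case False
    have "expectation (\<lambda>\<omega>. B i \<omega> * B j \<omega>) = expectation (indicator {\<omega> \<in> space M. s < z i \<omega> \<and> s < z j \<omega>})"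
      by (rule Bochner_Integration.integral_cong) (auto simp: B_def indicator_def)
    moreover have "{\<omega> \<in> space M. s < z i \<omega> \<and> s < z j \<omega>} \<inter> space M = {\<omega> \<in> space M. s < z i \<omega> \<and> s < z j \<omega>}"
      by auto
    ultimately have "expectation (\<lambda>\<omega>. B i \<omega> * B j \<omega>) = p\<^sup>2"
      using two[OF i j False] by simp
    with False show ?thesis by simp
  qed
  define W where "W \<omega> = (\<Sum>i=1..n. B i \<omega> - p) / real n" for \<omega>
  have W: "empirical_survival n (\<lambda>i. z i \<omega>) s - p = W \<omega>" for \<omega>
    using n by (simp add: W_def empirical_survival_def B_def of_bool_def sum_subtractf diff_divide_distrib del: sum_of_bool_eq)
  have Wsq: "(W \<omega>)\<^sup>2 = (\<Sum>i=1..n. \<Sum>j=1..n. B i \<omega> * B j \<omega> - p * B i \<omega> - p * B j \<omega> + p\<^sup>2) / (real n)\<^sup>2" for \<omega>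
    unfolding W_def power_divide power2_eq_square[of "sum _ _"] sum_product
    by (intro arg_cong[where f="\<lambda>x. x / _"] sum.cong refl) (simp add: algebra_simps power2_eq_square)
  have int_term: "integrable M (\<lambda>\<omega>. B i \<omega> * B j \<omega> - p * B i \<omega> - p * B j \<omega> + p\<^sup>2)" if "i \<in> {1..n}" "j \<in> {1..n}" for i j
    using that by (intro Bochner_Integration.integrable_add Bochner_Integration.integrable_diff BBi integrable_mult_right Bi) auto
  have E_term: "expectation (\<lambda>\<omega>. B i \<omega> * B j \<omega> - p * B i \<omega> - p * B j \<omega> + p\<^sup>2) = (if i = j then p - p\<^sup>2 else 0)"
    if "i \<in> {1..n}" "j \<in> {1..n}" for i j
    using that by (simp add: BBi Bi EB EBB prob_space power2_eq_square)
  have Wi: "integrable M W"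
    unfolding W_def by (intro integrable_divide Bochner_Integration.integrable_sum Bochner_Integration.integrable_diff Bi) auto
  have Wsqi: "integrable M (\<lambda>\<omega>. (W \<omega>)\<^sup>2)"
    unfolding Wsq by (intro integrable_divide Bochner_Integration.integrable_sum int_term)
  have "expectation (\<lambda>\<omega>. (W \<omega>)\<^sup>2) = (\<Sum>i=1..n. \<Sum>j=1..n. (if i = j then p - p\<^sup>2 else 0)) / (real n)\<^sup>2"
  proof -
    let ?T = "\<lambda>i j \<omega>. B i \<omega> * B j \<omega> - p * B i \<omega> - p * B j \<omega> + p\<^sup>2"
    have inner: "expectation (\<lambda>\<omega>. \<Sum>j=1..n. ?T i j \<omega>) = (\<Sum>j=1..n. (if i = j then p - p\<^sup>2 else 0))"
      if "i \<in> {1..n}" for i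
    proof -
      have "expectation (\<lambda>\<omega>. \<Sum>j=1..n. ?T i j \<omega>) = (\<Sum>j=1..n. expectation (?T i j))"
        by (rule Bochner_Integration.integral_sum) (rule int_term[OF that])
      also have "\<dots> = (\<Sum>j=1..n. (if i = j then p - p\<^sup>2 else 0))"
        by (intro sum.cong refl E_term that)
      finally show ?thesis .
    qed
    have "expectation (\<lambda>\<omega>. \<Sum>i=1..n. \<Sum>j=1..n. ?T i j \<omega>) = (\<Sum>i=1..n. expectation (\<lambda>\<omega>. \<Sum>j=1..n. ?T i j \<omega>))"
      by (intro Bochner_Integration.integral_sum Bochner_Integration.integrable_sum int_term)
    also have "\<dots> = (\<Sum>i=1..n. \<Sum>j=1..n. (if i = j then p - p\<^sup>2 else 0))"
      by (intro sum.cong refl inner)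
    finally show ?thesis unfolding Wsq by (simp only: integral_divide_zero)
  qed
  also have "\<dots> = (p - p\<^sup>2) / real n"
    using n by (simp add: power2_eq_square)
  also have "\<dots> \<le> 1 / real n"
    using p by (intro divide_right_mono) (auto simp: power2_eq_square intro: order_trans[of _ p])
  finally have EW2: "expectation (\<lambda>\<omega>. (W \<omega>)\<^sup>2) \<le> 1 / real n" .
  \<comment> \<open>Nonnegativity of the variance of \<open>\<bar>W\<bar>\<close> bounds the squared
    first absolute moment by the second moment.\<close>
  have "0 \<le> expectation (\<lambda>\<omega>. \<bar>W \<omega>\<bar>\<^sup>2) - (expectation (\<lambda>\<omega>. \<bar>W \<omega>\<bar>))\<^sup>2"
    using variance_positive[of "\<lambda>\<omega>. \<bar>W \<omega>\<bar>"] Wi Wsqi by (subst (asm) variance_eq) auto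
  with EW2 have "(expectation (\<lambda>\<omega>. \<bar>W \<omega>\<bar>))\<^sup>2 \<le> 1 / real n" by simp
  then have "expectation (\<lambda>\<omega>. \<bar>W \<omega>\<bar>) \<le> sqrt (1 / real n)" by (rule real_le_rsqrt)
  moreover have "expectation (\<lambda>\<omega>. \<bar>W \<omega>\<bar>) \<le> 2 * p"
  proof -
    have "expectation (\<lambda>\<omega>. \<bar>W \<omega>\<bar>) \<le> expectation (\<lambda>\<omega>. (\<Sum>i=1..n. B i \<omega>) / real n + p)"
    proof (rule integral_mono)
      show "\<bar>W \<omega>\<bar> \<le> (\<Sum>i=1..n. B i \<omega>) / real n + p" for \<omega>
      proof -
        have "W \<omega> = (\<Sum>i=1..n. B i \<omega>) / real n - p"
          using n by (simp add: W_def sum_subtractf diff_divide_distrib)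
        moreover have "0 \<le> (\<Sum>i=1..n. B i \<omega>) / real n"
          by (auto simp: B_def intro!: sum_nonneg divide_nonneg_nonneg)
        ultimately show ?thesis using p by linarith
      qed
    qed (use Wi Bi in \<open>auto intro!: Bochner_Integration.integrable_add integrable_divide Bochner_Integration.integrable_sum\<close>)
    also have "\<dots> = 2 * p"
    proof -
      have "expectation (\<lambda>\<omega>. \<Sum>i=1..n. B i \<omega>) = (\<Sum>i=1..n. expectation (B i))"
        by (rule Bochner_Integration.integral_sum) (rule Bi)
      also have "\<dots> = (\<Sum>i=1..n. p)"
        by (intro sum.cong refl EB)
      finally have "expectation (\<lambda>\<omega>. \<Sum>i=1..n. B i \<omega>) = real n * p" by simp
      moreover have "integrable M (\<lambda>\<omega>. \<Sum>i=1..n. B i \<omega>)"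
        by (intro Bochner_Integration.integrable_sum Bi)
      ultimately show ?thesis using n by (simp add: prob_space)
    qed
    finally show ?thesis .
  qed
  moreover have "(\<integral>\<^sup>+\<omega>. ennreal \<bar>empirical_survival n (\<lambda>i. z i \<omega>) s - p\<bar> \<partial>M) = ennreal (expectation (\<lambda>\<omega>. \<bar>W \<omega>\<bar>))"
    unfolding W using Wi by (intro nn_integral_eq_integral) auto
  ultimately show ?thesis
    by (auto simp: real_sqrt_divide intro!: ennreal_leI)
qed

lemma (in prob_space) empirical_survival_distance_le:
  fixes z :: "nat \<Rightarrow> 'a \<Rightarrow> real"
  assumes n: "1 \<le> n" and z: "\<And>i. i \<in> {1..n} \<Longrightarrow> z i \<in> borel_measurable M"
    and \<eta>: "sigma_finite_measure \<eta>" "sets \<eta> = sets borel" "AE s in \<eta>. 0 \<le> s"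
    and G: "G \<in> borel_measurable borel"
    and one: "\<And>i s. i \<in> {1..n} \<Longrightarrow> 0 \<le> s \<Longrightarrow> prob {\<omega> \<in> space M. s < z i \<omega>} = G s"
    and two: "\<And>i j s. i \<in> {1..n} \<Longrightarrow> j \<in> {1..n} \<Longrightarrow> i \<noteq> j \<Longrightarrow> 0 \<le> s \<Longrightarrow>
      prob {\<omega> \<in> space M. s < z i \<omega> \<and> s < z j \<omega>} = (G s)\<^sup>2"
  defines "D \<equiv> \<lambda>\<omega>. \<integral>\<^sup>+s. ennreal \<bar>empirical_survival n (\<lambda>i. z i \<omega>) s - G s\<bar> \<partial>\<eta>"
  shows "D \<in> borel_measurable M"
    and "(\<integral>\<^sup>+\<omega>. D \<omega> \<partial>M) \<le> (\<integral>\<^sup>+s. ennreal (min (2 * G s) (1 / sqrt (real n))) \<partial>\<eta>)"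
proof -
  interpret \<eta>: sigma_finite_measure \<eta> by fact
  interpret pair_sigma_finite M \<eta> ..
  note [measurable] = z G and [measurable_cong] = \<eta>(2)
  have eq: "empirical_survival n (\<lambda>i. z i \<omega>) s = (\<Sum>i=1..n. (if s < z i \<omega> then 1 else 0)) / real n" for \<omega> s
    by (simp add: empirical_survival_def of_bool_def del: sum_of_bool_eq)
  have [measurable]: "(\<lambda>(\<omega>, s). ennreal \<bar>empirical_survival n (\<lambda>i. z i \<omega>) s - G s\<bar>) \<in> borel_measurable (M \<Otimes>\<^sub>M \<eta>)"
    unfolding eq by measurable
  show "D \<in> borel_measurable M"
    unfolding D_def by measurable
  have "(\<integral>\<^sup>+\<omega>. D \<omega> \<partial>M) = (\<integral>\<^sup>+s. \<integral>\<^sup>+\<omega>. ennreal \<bar>empirical_survival n (\<lambda>i. z i \<omega>) s - G s\<bar> \<partial>M \<partial>\<eta>)"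
    unfolding D_def by (rule Fubini'[symmetric]) measurable
  also have "\<dots> \<le> (\<integral>\<^sup>+s. ennreal (min (2 * G s) (1 / sqrt (real n))) \<partial>\<eta>)"
    by (rule nn_integral_mono_AE)
      (use \<eta>(3) in eventually_elim, rule empirical_survival_L1_le[OF n z one two])
  finally show "(\<integral>\<^sup>+\<omega>. D \<omega> \<partial>M) \<le> (\<integral>\<^sup>+s. ennreal (min (2 * G s) (1 / sqrt (real n))) \<partial>\<eta>)" .
qed

section \<open>Passage to the limit and truncation\<close>

lemma tendsto_survival_bound:
  fixes G :: "real \<Rightarrow> real"
  assumes \<eta>: "sets \<eta> = sets borel"
    and G [measurable]: "G \<in> borel_measurable borel" "\<And>s. 0 \<le> G s"
    and fin: "(\<integral>\<^sup>+s. ennreal (G s) \<partial>\<eta>) < \<infinity>"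
  shows "(\<lambda>M. \<integral>\<^sup>+s. ennreal (min (2 * G s) (1 / sqrt (real (2 * M)))) \<partial>\<eta>) \<longlonglongrightarrow> 0"
proof -
  note [measurable_cong] = \<eta>
  have lim: "(\<lambda>M. 1 / sqrt (real (2 * M))) \<longlonglongrightarrow> 0"
  proof -
    have "filterlim (\<lambda>M. sqrt (real (2 * M))) at_top sequentially"
      by (intro filterlim_compose[OF sqrt_at_top] filterlim_compose[OF filterlim_real_sequentially])
        (auto intro: filterlim_subseq simp: strict_mono_def)
    then show ?thesis
      by (intro tendsto_divide_0[OF tendsto_const] filterlim_at_top_imp_at_infinity)
  qed
  have "(\<lambda>M. \<integral>\<^sup>+s. ennreal (min (2 * G s) (1 / sqrt (real (2 * M)))) \<partial>\<eta>) \<longlonglongrightarrow> (\<integral>\<^sup>+s. ennreal 0 \<partial>\<eta>)"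
  proof (rule nn_integral_dominated_convergence)
    show "(\<integral>\<^sup>+s. ennreal (2 * G s) \<partial>\<eta>) < \<infinity>"
      using fin by (simp add: ennreal_mult' nn_integral_cmult ennreal_mult_less_top)
    show "AE s in \<eta>. (\<lambda>M. ennreal (min (2 * G s) (1 / sqrt (real (2 * M))))) \<longlonglongrightarrow> ennreal 0"
    proof (intro AE_I2 tendsto_ennrealI)
      fix s
      have "(\<lambda>M. min (2 * G s) (1 / sqrt (real (2 * M)))) \<longlonglongrightarrow> min (2 * G s) 0"
        by (intro tendsto_min tendsto_const lim)
      moreover have "min (2 * G s) 0 = 0" using G(2)[of s] by simp
      ultimately show "(\<lambda>M. min (2 * G s) (1 / sqrt (real (2 * M)))) \<longlonglongrightarrow> 0" by (simp only:)
    qed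
  qed (auto intro!: ennreal_leI)
  then show ?thesis by simp
qed

lemma tendsto_measure_0I:
  fixes P :: "nat \<Rightarrow> 'a measure"
  assumes "\<And>M. 1 \<le> M \<Longrightarrow> prob_space (P M)"
    and le: "\<And>M. 1 \<le> M \<Longrightarrow> emeasure (P M) (E M) \<le> c * B M"
    and c: "c < \<infinity>" and B: "B \<longlonglongrightarrow> (0 :: ennreal)"
  shows "(\<lambda>M. measure (P M) (E M)) \<longlonglongrightarrow> 0"
proof -
  have "(\<lambda>M. c * B M) \<longlonglongrightarrow> c * 0"
    using c B by (intro ennreal_tendsto_cmult) auto
  then have cB: "(\<lambda>M. c * B M) \<longlonglongrightarrow> 0" by simp
  have "\<forall>\<^sub>F M in sequentially. ennreal (measure (P M) (E M)) \<le> c * B M"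
    using eventually_ge_at_top[of 1]
  proof eventually_elim
    case (elim M)
    then interpret prob_space "P M" using assms(1) by blast
    show ?case using le[OF elim] by (simp add: emeasure_eq_measure)
  qed
  then have "(\<lambda>M. ennreal (measure (P M) (E M))) \<longlonglongrightarrow> ennreal 0"
    unfolding ennreal_0 by (intro tendsto_sandwich[OF _ _ tendsto_const cB]) auto
  then show ?thesis
    by (rule tendsto_ennrealD) auto
qed

lemma survival_integral_le:
  assumes A: "A \<in> sets borel" and [measurable]: "g \<in> borel_measurable borel" "g' \<in> borel_measurable borel"
    and nonneg: "\<And>s. 0 \<le> g' s"
  shows "(\<integral>\<^sup>+s. ennreal (g s) \<partial>log_measure A)
    \<le> (\<integral>\<^sup>+s. ennreal (g' s) \<partial>log_measure A) + (\<integral>\<^sup>+s. ennreal \<bar>g' s - g s\<bar> \<partial>log_measure A)"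
proof -
  have "(\<integral>\<^sup>+s. ennreal (g s) \<partial>log_measure A) \<le> (\<integral>\<^sup>+s. ennreal (g' s) + ennreal \<bar>g' s - g s\<bar> \<partial>log_measure A)"
  proof (rule nn_integral_mono)
    fix s
    have "ennreal (g s) \<le> ennreal (g' s + \<bar>g' s - g s\<bar>)" by (intro ennreal_leI) simp
    also have "\<dots> = ennreal (g' s) + ennreal \<bar>g' s - g s\<bar>" using nonneg by (simp add: ennreal_plus)
    finally show "ennreal (g s) \<le> ennreal (g' s) + ennreal \<bar>g' s - g s\<bar>" .
  qed
  also have "\<dots> = (\<integral>\<^sup>+s. ennreal (g' s) \<partial>log_measure A) + (\<integral>\<^sup>+s. ennreal \<bar>g' s - g s\<bar> \<partial>log_measure A)"
    by (rule nn_integral_add) measurable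
  finally show ?thesis .
qed

lemma log_measure_mono:
  assumes [measurable]: "A \<in> sets borel" "g \<in> borel_measurable borel"
  shows "(\<integral>\<^sup>+s. g s \<partial>log_measure A) \<le> (\<integral>\<^sup>+s. g s \<partial>log_measure UNIV)"
  by (simp add: nn_integral_log_measure)
    (intro nn_integral_mono mult_right_mono ennreal_leI, auto simp: indicator_def)

lemma log_measure_atMost_finite:
  assumes [measurable]: "g \<in> borel_measurable borel" and "\<And>s. g s \<le> 1"
  shows "(\<integral>\<^sup>+s. ennreal (g s) \<partial>log_measure {..a}) < \<infinity>"
proof -
  have "(\<integral>\<^sup>+s. ennreal (g s) \<partial>log_measure {..a}) = (\<integral>\<^sup>+s. ennreal (indicator ({..a} \<inter> {0..}) s / (1 + s)) * ennreal (g s) \<partial>lborel)"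
    by (simp add: nn_integral_log_measure)
  also have "\<dots> \<le> (\<integral>\<^sup>+s. indicator {0..a} s \<partial>lborel)"
  proof (rule nn_integral_mono)
    fix s
    have "ennreal (g s) \<le> 1" using assms(2)[of s] by simp
    moreover have "ennreal (indicator ({..a} \<inter> {0..}) s / (1 + s)) \<le> indicator {0..a} s"
      by (auto simp: indicator_def)
    ultimately show "ennreal (indicator ({..a} \<inter> {0..}) s / (1 + s)) * ennreal (g s) \<le> indicator {0..a} s"
      using mult_mono[of "ennreal (indicator ({..a} \<inter> {0..}) s / (1 + s))" "indicator {0..a} s" "ennreal (g s)" 1] by simp
  qed
  also have "\<dots> < \<infinity>"
    by (cases "0 \<le> a") (simp_all)
  finally show ?thesis .
qed

text \<open>Monotone convergence along the half-lines \<open>{..real n}\<close>: a divergent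
  integral exceeds any prescribed bound already on a bounded range, where the distance to the
  empirical function can be controlled.\<close>

lemma log_measure_atMost_exhaust:
  assumes [measurable]: "g \<in> borel_measurable borel"
    and inf: "(\<integral>\<^sup>+s. g s \<partial>log_measure UNIV) = \<infinity>"
  shows "\<exists>a. ennreal k < (\<integral>\<^sup>+s. g s \<partial>log_measure {..a})"
proof -
  define w where "w n s = ennreal (indicator ({..real n} \<inter> {0..}) s / (1 + s)) * g s" for n s
  have "incseq w"
    unfolding w_def incseq_def le_fun_def
    by (intro allI impI mult_right_mono ennreal_leI) (auto simp: indicator_def)
  then have "(\<integral>\<^sup>+s. (SUP n. w n s) \<partial>lborel) = (SUP n. \<integral>\<^sup>+s. w n s \<partial>lborel)"
    by (rule nn_integral_monotone_convergence_SUP) (unfold w_def[abs_def], measurable)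
  moreover have "(SUP n. w n s) = ennreal (indicator (UNIV \<inter> {0..}) s / (1 + s)) * g s" for s
  proof (rule antisym)
    show "(SUP n. w n s) \<le> ennreal (indicator (UNIV \<inter> {0..}) s / (1 + s)) * g s"
      unfolding w_def by (intro SUP_least mult_right_mono ennreal_leI) (auto simp: indicator_def)
    have "s \<le> real (nat \<lceil>s\<rceil>)" by linarith
    then have "w (nat \<lceil>s\<rceil>) s = ennreal (indicator (UNIV \<inter> {0..}) s / (1 + s)) * g s"
      by (simp add: w_def indicator_def)
    then show "ennreal (indicator (UNIV \<inter> {0..}) s / (1 + s)) * g s \<le> (SUP n. w n s)"
      by (metis SUP_upper UNIV_I)
  qed
  ultimately have "(SUP n. \<integral>\<^sup>+s. w n s \<partial>lborel) = \<infinity>"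
    using inf by (simp add: nn_integral_log_measure)
  then have "ennreal k < (SUP n. \<integral>\<^sup>+s. w n s \<partial>lborel)"
    by (simp only: infinity_ennreal_def ennreal_less_top)
  then have "\<exists>n\<in>UNIV. ennreal k < (\<integral>\<^sup>+s. w n s \<partial>lborel)"
    unfolding less_SUP_iff .
  then show ?thesis
    unfolding w_def by (auto simp: nn_integral_log_measure)
qed

section \<open>Convergence of the optimal rate\<close>

lemma average_rate_eq:
  "average_rate M g h l = sum_ln_rate M (\<lambda>i. g i * (cmod (h i))\<^sup>2) l / real M / (2 * ln 2)"
  by (simp add: average_rate_def pair_rate_def sum_ln_rate_def log_def sum_divide_distrib[symmetric])

lemma sum_pair_rate_eq:
  "(\<Sum>m=1..M. pair_rate g h l m) = sum_ln_rate M (\<lambda>i. g i * (cmod (h i))\<^sup>2) l / ln 2"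
  by (simp add: pair_rate_def sum_ln_rate_def log_def sum_divide_distrib[symmetric])

lemma optimal_pairing_sum_ln_rate:
  assumes "optimal_pairing M g h l"
  defines "z \<equiv> \<lambda>i. g i * (cmod (h i))\<^sup>2"
  shows "pairing M l" "pairing M l' \<Longrightarrow> sum_ln_rate M z l' \<le> sum_ln_rate M z l"
  using assms(1) unfolding optimal_pairing_def sum_pair_rate_eq z_def by (simp_all add: divide_le_cancel)

lemma pairing_range:
  assumes "pairing M l" "m \<in> {1..M}"
  shows "l (2*m-1) \<in> {1..2*M}" "l (2*m) \<in> {1..2*M}"
proof -
  have "2*m-1 \<in> {1..2*M}" "2*m \<in> {1..2*M}" using assms(2) by auto
  then show "l (2*m-1) \<in> {1..2*M}" "l (2*m) \<in> {1..2*M}"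
    using bij_betw_apply[OF assms(1)[unfolded pairing_iff_bij_betw]] by simp_all
qed

lemma sum_ln_rate_nonneg:
  assumes "pairing M l" "\<And>i. i \<in> {1..2*M} \<Longrightarrow> 0 \<le> z i"
  shows "0 \<le> sum_ln_rate M z l"
  unfolding sum_ln_rate_def
proof (rule sum_nonneg)
  fix m assume "m \<in> {1..M}"
  then have "0 \<le> z (l (2*m-1))" "0 \<le> z (l (2*m))"
    using pairing_range[OF assms(1)] assms(2) by blast+
  then show "0 \<le> ln (1 + z (l (2*m-1)) + z (l (2*m)))" by simp
qed

text \<open>The optimal pairing itself need not depend measurably on the outcome, but its rate is a maximum
  of finitely many measurable functions.\<close>

lemma borel_measurable_average_rate:
  assumes g: "\<And>i. i \<in> {1..2*M} \<Longrightarrow> g i \<in> borel_measurable N"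
    and h: "\<And>i. i \<in> {1..2*M} \<Longrightarrow> h i \<in> borel_measurable N"
    and opt: "\<And>\<omega>. \<omega> \<in> space N \<Longrightarrow> optimal_pairing M (\<lambda>i. g i \<omega>) (\<lambda>i. h i \<omega>) (l \<omega>)"
  shows "(\<lambda>\<omega>. average_rate M (\<lambda>i. g i \<omega>) (\<lambda>i. h i \<omega>) (l \<omega>)) \<in> borel_measurable N"
proof -
  \<comment> \<open>Extensional functions are used because pairings as functions on all naturals,
    with arbitrary values off the users, form an infinite set.\<close>
  define \<L> where "\<L> = {l \<in> {1..2*M} \<rightarrow>\<^sub>E {1..2*M}. pairing M l}"
  define v where "v l \<omega> = (\<Sum>m=1..M. pair_rate (\<lambda>i. g i \<omega>) (\<lambda>i. h i \<omega>) l m)" for l \<omega>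
  have fin: "finite \<L>"
    unfolding \<L>_def by (intro finite_subset[OF Collect_restrict] finite_PiE) auto
  have meas: "v l \<in> borel_measurable N" if "l \<in> \<L>" for l
  proof -
    have [measurable]: "g (l (2*m-1)) \<in> borel_measurable N" "g (l (2*m)) \<in> borel_measurable N"
      "h (l (2*m-1)) \<in> borel_measurable N" "h (l (2*m)) \<in> borel_measurable N" if "m \<in> {1..M}" for m
      using g h pairing_range[of M l m] \<open>l \<in> \<L>\<close> that by (simp_all add: \<L>_def)
    show ?thesis unfolding v_def[abs_def] pair_rate_def log_def by measurable
  qed
  have max: "v (l \<omega>) \<omega> = Max ((\<lambda>l. v l \<omega>) ` \<L>)" if \<omega>: "\<omega> \<in> space N" for \<omega>
  proof (rule Max_eqI[symmetric])
    show "finite ((\<lambda>l. v l \<omega>) ` \<L>)" using fin by simp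
    show "y \<le> v (l \<omega>) \<omega>" if "y \<in> (\<lambda>l. v l \<omega>) ` \<L>" for y
      using that opt[OF \<omega>] by (auto simp: \<L>_def optimal_pairing_def v_def)
    \<comment> \<open>Rates evaluate a pairing only at \<open>1, ..., 2 * M\<close>, so restriction
      changes none of them.\<close>
    define k where "k = restrict (l \<omega>) {1..2*M}"
    have l: "pairing M (l \<omega>)" using opt[OF \<omega>] by (simp add: optimal_pairing_def)
    have bij: "bij_betw k {1..2*M} {1..2*M}"
      using l unfolding pairing_iff_bij_betw k_def by (subst bij_betw_cong[of _ _ "l \<omega>"]) auto
    then have "k \<in> \<L>"
      unfolding \<L>_def pairing_iff_bij_betw mem_Collect_eq
      by (intro conjI PiE_I bij_betw_apply[OF bij]) (auto simp: k_def)
    moreover have "v k \<omega> = v (l \<omega>) \<omega>"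
      unfolding v_def pair_rate_def k_def by (intro sum.cong) auto
    ultimately show "v (l \<omega>) \<omega> \<in> (\<lambda>l. v l \<omega>) ` \<L>" by (metis imageI)
  qed
  have "(\<lambda>\<omega>. Max ((\<lambda>l. v l \<omega>) ` \<L>)) \<in> borel_measurable N"
    by (rule borel_measurable_Max[OF fin meas])
  then have "(\<lambda>\<omega>. v (l \<omega>) \<omega>) \<in> borel_measurable N"
    by (subst measurable_cong[OF max])
  then show ?thesis
    unfolding average_rate_def v_def[symmetric] by measurable
qed

lemma empirical_survival_integral_finite:
  assumes "\<And>i. i \<in> {1..n} \<Longrightarrow> 0 \<le> z i"
  shows "(\<integral>\<^sup>+s. ennreal (empirical_survival n z s) \<partial>log_measure UNIV) < \<infinity>"
proof -
  \<comment> \<open>Any common upper bound of the sample would do; the sum also covers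
    \<open>n = 0\<close>.\<close>
  define Z where "Z = (\<Sum>i=1..n. z i)"
  have Z: "0 \<le> Z" "\<And>i. i \<in> {1..n} \<Longrightarrow> z i \<le> Z"
    using assms by (auto simp: Z_def intro!: sum_nonneg member_le_sum)
  have "(\<integral>\<^sup>+s. ennreal (empirical_survival n z s) \<partial>log_measure UNIV) \<le> (\<integral>\<^sup>+s. indicator {..<Z} s \<partial>log_measure UNIV)"
  proof (rule nn_integral_mono)
    fix s
    show "ennreal (empirical_survival n z s) \<le> indicator {..<Z} s"
    proof (cases "s < Z")
      case False
      then have "(\<Sum>i=1..n. of_bool (s < z i)) = (0 :: real)"
        using Z(2) by (intro sum.neutral) (force simp: not_less)
      with False show ?thesis by (simp only: empirical_survival_def) simp
    qed (simp add: empirical_survival_le_1)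
  qed
  also have "\<dots> < \<infinity>" using Z(1) by (simp add: emeasure_log_measure_less)
  finally show ?thesis .
qed

definition survival_distance :: "(real \<Rightarrow> real) \<Rightarrow> real set \<Rightarrow> nat \<Rightarrow> (nat \<Rightarrow> real) \<Rightarrow> ennreal" where
  "survival_distance G A n z = (\<integral>\<^sup>+s. ennreal \<bar>empirical_survival n z s - G s\<bar> \<partial>log_measure A)"

section \<open>Deterministic comparison of the optimal rate with its limit\<close>

context positive_density
begin

text \<open>The empirical and the limiting identity have the same shape, so
  \<open>ennreal_sandwich\<close> applies with the roles exchanged. The cancelled overlaps are
  finite for different reasons: the sample is bounded, and the limit rate is finite.\<close>

lemma sum_ln_rate_near_rate_integral:
  assumes M: "1 \<le> M" and l: "pairing M l" and z: "\<And>i. i \<in> {1..2*M} \<Longrightarrow> 0 \<le> z i"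
    and opt: "\<And>l'. pairing M l' \<Longrightarrow> sum_ln_rate M z l' \<le> sum_ln_rate M z l"
    and fin: "rate_integral < \<infinity>"
  defines "X \<equiv> ennreal (sum_ln_rate M z l / real M)"
    and "D \<equiv> survival_distance (survival f) UNIV (2*M) z"
  shows "X \<le> rate_integral + 4 * D" "rate_integral \<le> X + 4 * D"
proof -
  let ?E = "empirical_survival (2*M) z" and ?G = "survival f"
  have D': "D = (\<integral>\<^sup>+s. ennreal \<bar>?G s - ?E s\<bar> \<partial>log_measure UNIV)"
    by (simp add: D_def survival_distance_def abs_minus_commute)
  note X = sum_ln_rate_optimal[OF M l z opt, folded X_def]
  have "overlap_integral ?E \<le> (\<integral>\<^sup>+s. ennreal (?E s) \<partial>log_measure UNIV)"
    by (rule overlap_integral_le) (simp_all add: empirical_survival_le_1)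
  then have J': "overlap_integral ?E < \<infinity>"
    using empirical_survival_integral_finite[of "2*M" z] z by (simp add: le_less_trans)
  have "overlap_integral ?G \<le> (\<integral>\<^sup>+s. ennreal (?G s) \<partial>log_measure UNIV)"
    by (rule overlap_integral_le) (simp_all add: survival_le_1)
  then have J: "overlap_integral ?G < \<infinity>"
    using survival_integral_le_rate_integral fin by (meson le_less_trans)
  show "X \<le> rate_integral + 4 * D"
  proof (rule ennreal_sandwich[OF X rate_integral_identity _ _ J'])
    show "(\<integral>\<^sup>+s. ennreal (?E s) \<partial>log_measure UNIV) \<le> (\<integral>\<^sup>+s. ennreal (?G s) \<partial>log_measure UNIV) + D"
      unfolding D' by (rule survival_integral_le) (simp_all add: survival_nonneg)
    show "overlap_integral ?G \<le> overlap_integral ?E + 2 * D"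
      unfolding D' by (rule overlap_integral_lipschitz) simp_all
  qed
  show "rate_integral \<le> X + 4 * D"
  proof (rule ennreal_sandwich[OF rate_integral_identity X _ _ J])
    show "(\<integral>\<^sup>+s. ennreal (?G s) \<partial>log_measure UNIV) \<le> (\<integral>\<^sup>+s. ennreal (?E s) \<partial>log_measure UNIV) + D"
      unfolding D_def survival_distance_def by (rule survival_integral_le) (simp_all add: empirical_survival_nonneg)
    show "overlap_integral ?E \<le> overlap_integral ?G + 2 * D"
      unfolding D_def survival_distance_def by (rule overlap_integral_lipschitz) simp_all
  qed
qed

text \<open>Since the overlap is at most the survival integral \<open>I\<close>, the optimal
  identity gives \<open>2 * I \<le> X + I\<close>, and the finite \<open>I\<close> of the sample
  cancels. Finiteness of the limit plays no part, so \<open>A\<close> can be a truncation when the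
  limit is infinite.\<close>

lemma sum_ln_rate_lower:
  assumes M: "1 \<le> M" and l: "pairing M l" and z: "\<And>i. i \<in> {1..2*M} \<Longrightarrow> 0 \<le> z i"
    and opt: "\<And>l'. pairing M l' \<Longrightarrow> sum_ln_rate M z l' \<le> sum_ln_rate M z l"
    and A [measurable]: "A \<in> sets borel"
  shows "(\<integral>\<^sup>+s. ennreal (survival f s) \<partial>log_measure A)
    \<le> ennreal (sum_ln_rate M z l / real M) + survival_distance (survival f) A (2*M) z"
proof -
  let ?E = "empirical_survival (2*M) z" and ?X = "ennreal (sum_ln_rate M z l / real M)"
  let ?I = "\<integral>\<^sup>+s. ennreal (?E s) \<partial>log_measure UNIV"
  have J: "overlap_integral ?E \<le> ?I"
    by (rule overlap_integral_le) (simp_all add: empirical_survival_le_1)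
  have I: "?I < \<infinity>"
    by (rule empirical_survival_integral_finite) (rule z)
  have "?I + ?I = ?X + overlap_integral ?E"
    using sum_ln_rate_optimal[OF M l z opt] by (simp add: mult_2)
  also have "\<dots> \<le> ?X + ?I" using J by (rule add_left_mono)
  finally have "?I + ?I \<le> ?I + ?X" by (simp only: add.commute)
  then have IX: "?I \<le> ?X"
    using I by (auto simp: ennreal_add_left_cancel_le)
  have "(\<integral>\<^sup>+s. ennreal (survival f s) \<partial>log_measure A)
    \<le> (\<integral>\<^sup>+s. ennreal (?E s) \<partial>log_measure A) + survival_distance (survival f) A (2*M) z"
    unfolding survival_distance_def by (rule survival_integral_le) (simp_all add: empirical_survival_nonneg)
  also have "\<dots> \<le> ?X + survival_distance (survival f) A (2*M) z"
    by (intro add_right_mono order_trans[OF log_measure_mono IX]) simp_all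
  finally show ?thesis .
qed

end

lemma (in prob_space) survival_distance_le:
  fixes h :: "nat \<Rightarrow> 'a \<Rightarrow> complex" and \<gamma> :: "nat \<Rightarrow> 'a \<Rightarrow> real"
  assumes f: "positive_density f" and n: "1 \<le> n" and A: "A \<in> sets borel"
    and h: "\<And>i. i \<in> {1..n} \<Longrightarrow> std_complex_normal M (h i)" "indep_vars (\<lambda>_. borel) h {1..n}"
    and \<gamma>: "\<And>i. i \<in> {1..n} \<Longrightarrow> distributed M lborel (\<gamma> i) f" "indep_vars (\<lambda>_. borel) \<gamma> {1..n}"
    and indep: "indep_rv M (\<Pi>\<^sub>M i\<in>{1..n}. borel) (\<lambda>\<omega>. \<lambda>i\<in>{1..n}. h i \<omega>)
      (\<Pi>\<^sub>M i\<in>{1..n}. borel) (\<lambda>\<omega>. \<lambda>i\<in>{1..n}. \<gamma> i \<omega>)"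
  defines "D \<equiv> \<lambda>\<omega>. survival_distance (survival f) A n (\<lambda>i. \<gamma> i \<omega> * (cmod (h i \<omega>))\<^sup>2)"
  shows "D \<in> borel_measurable M"
    and "(\<integral>\<^sup>+\<omega>. D \<omega> \<partial>M) \<le> (\<integral>\<^sup>+s. ennreal (min (2 * survival f s) (1 / sqrt (real n))) \<partial>log_measure A)"
proof -
  interpret positive_density f by fact
  define z where "z i \<omega> = \<gamma> i \<omega> * (cmod (h i \<omega>))\<^sup>2" for i \<omega>
  have z: "z i \<in> borel_measurable M" if "i \<in> {1..n}" for i
  proof -
    have [measurable]: "h i \<in> borel_measurable M" "\<gamma> i \<in> borel_measurable M"
      using h(2) \<gamma>(2) that by (simp_all add: indep_vars_def)
    show ?thesis unfolding z_def[abs_def] by measurable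
  qed
  have joint: "prob {\<omega> \<in> space M. \<forall>i\<in>J. s < z i \<omega>} = survival f s ^ card J"
    if "J \<subseteq> {1..n}" "0 \<le> s" for J s
  proof -
    have "emeasure M {\<omega> \<in> space M. \<forall>i\<in>J. s < z i \<omega>} = ennreal (survival f s ^ card J)"
      unfolding z_def by (rule joint_survival[OF f finite_subset[OF that(1)] that h \<gamma> indep]) simp
    then show ?thesis
      by (simp add: emeasure_eq_measure survival_nonneg)
  qed
  have one: "prob {\<omega> \<in> space M. s < z i \<omega>} = survival f s" if "i \<in> {1..n}" "0 \<le> s" for i s
    using joint[of "{i}" s] that by simp
  have two: "prob {\<omega> \<in> space M. s < z i \<omega> \<and> s < z j \<omega>} = (survival f s)\<^sup>2"
    if "i \<in> {1..n}" "j \<in> {1..n}" "i \<noteq> j" "0 \<le> s" for i j s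
    using joint[of "{i, j}" s] that by (simp add: power2_eq_square)
  show "D \<in> borel_measurable M"
    unfolding D_def survival_distance_def z_def[symmetric]
    by (rule empirical_survival_distance_le(1)[OF n z sigma_finite_log_measure[OF A] sets_log_measure
          AE_log_measure_nonneg[OF A] borel_measurable_survival one two])
  show "(\<integral>\<^sup>+\<omega>. D \<omega> \<partial>M) \<le> (\<integral>\<^sup>+s. ennreal (min (2 * survival f s) (1 / sqrt (real n))) \<partial>log_measure A)"
    unfolding D_def survival_distance_def z_def[symmetric]
    by (rule empirical_survival_distance_le(2)[OF n z sigma_finite_log_measure[OF A] sets_log_measure
          AE_log_measure_nonneg[OF A] borel_measurable_survival one two])
qed

text \<open>The inclusion is required only almost surely, because the nonnegativity of the received
  powers, on which the deterministic estimates rest, is itself only almost sure.\<close>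

lemma (in prob_space) emeasure_le_Markov:
  assumes [measurable]: "D \<in> borel_measurable M" and \<delta>: "0 < \<delta>"
    and E: "AE \<omega> in M. \<omega> \<in> E \<longrightarrow> ennreal \<delta> \<le> D \<omega>"
  shows "emeasure M E \<le> ennreal (1 / \<delta>) * (\<integral>\<^sup>+\<omega>. D \<omega> \<partial>M)"
proof -
  have "emeasure M E \<le> emeasure M {\<omega> \<in> space M. 1 \<le> ennreal (1 / \<delta>) * D \<omega>}"
  proof (rule emeasure_mono_AE)
    show "AE \<omega> in M. \<omega> \<in> E \<longrightarrow> \<omega> \<in> {\<omega> \<in> space M. 1 \<le> ennreal (1 / \<delta>) * D \<omega>}"
      using E AE_space
    proof eventually_elim
      case (elim \<omega>)
      have "1 = ennreal (1 / \<delta>) * ennreal \<delta>"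
        using \<delta> by (simp add: ennreal_mult'[symmetric])
      also have "\<dots> \<le> ennreal (1 / \<delta>) * D \<omega>" if "\<omega> \<in> E"
        using elim that by (intro mult_left_mono) auto
      finally show ?case using elim by simp
    qed
  qed measurable
  also have "\<dots> \<le> ennreal (1 / \<delta>) * (\<integral>\<^sup>+\<omega>. D \<omega> * indicator (space M) \<omega> \<partial>M)"
    by (rule nn_integral_Markov_inequality) auto
  also have "(\<integral>\<^sup>+\<omega>. D \<omega> * indicator (space M) \<omega> \<partial>M) = (\<integral>\<^sup>+\<omega>. D \<omega> \<partial>M)"
    by (rule nn_integral_cong) simp
  finally show ?thesis .
qed

lemma positive_densityI:
  assumes "\<And>x. 0 \<le> f x" "\<And>x. x \<le> 0 \<Longrightarrow> f x = 0"
    and M: "prob_space M" and Y: "distributed M lborel Y f"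
  shows "positive_density f"
proof
  interpret prob_space M by fact
  show "f \<in> borel_measurable borel"
    using distributed_real_measurable[OF _ Y] assms(1) by simp
  show "(\<integral>\<^sup>+x. ennreal (f x) \<partial>lborel) = 1"
    using distributed_nn_integral[OF Y, of "\<lambda>_. 1"] by (simp add: emeasure_space_1)
qed (use assms in auto)

theorem theorem3:
  fixes P :: "nat \<Rightarrow> 'a measure"
    and h :: "nat \<Rightarrow> nat \<Rightarrow> 'a \<Rightarrow> complex"
    and \<gamma> :: "nat \<Rightarrow> nat \<Rightarrow> 'a \<Rightarrow> real"
    and f :: "real \<Rightarrow> real"
    and l :: "nat \<Rightarrow> 'a \<Rightarrow> nat \<Rightarrow> nat"
  assumes "\<And>x. 0 \<le> f x"
    and "\<And>x. x \<le> 0 \<Longrightarrow> f x = 0"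
    and "\<And>M. 1 \<le> M \<Longrightarrow> prob_space (P M)"
    and "\<And>M i. 1 \<le> M \<Longrightarrow> i \<in> {1..2*M} \<Longrightarrow> std_complex_normal (P M) (h M i)"
    and "\<And>M. 1 \<le> M \<Longrightarrow> prob_space.indep_vars (P M) (\<lambda>_. borel) (h M) {1..2*M}"
    and "\<And>M i. 1 \<le> M \<Longrightarrow> i \<in> {1..2*M} \<Longrightarrow> distributed (P M) lborel (\<gamma> M i) f"
    and "\<And>M. 1 \<le> M \<Longrightarrow> prob_space.indep_vars (P M) (\<lambda>_. borel) (\<gamma> M) {1..2*M}"
    and "\<And>M. 1 \<le> M \<Longrightarrow> indep_rv (P M)
           (\<Pi>\<^sub>M i\<in>{1..2*M}. borel) (\<lambda>\<omega>. \<lambda>i\<in>{1..2*M}. h M i \<omega>)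
           (\<Pi>\<^sub>M i\<in>{1..2*M}. borel) (\<lambda>\<omega>. \<lambda>i\<in>{1..2*M}. \<gamma> M i \<omega>)"
    and "\<And>M \<omega>. 1 \<le> M \<Longrightarrow> \<omega> \<in> space (P M) \<Longrightarrow>
           optimal_pairing M (\<lambda>i. \<gamma> M i \<omega>) (\<lambda>i. h M i \<omega>) (l M \<omega>)"
  shows "tendsto_in_prob P
           (\<lambda>M \<omega>. average_rate M (\<lambda>i. \<gamma> M i \<omega>) (\<lambda>i. h M i \<omega>) (l M \<omega>))
           (limit_rate f)"
proof -
  have f: "positive_density f"
    \<comment> \<open>All \<open>\<gamma> M i\<close> share the density \<open>f\<close>, so a
      single one, for \<open>M = 1\<close> and \<open>i = 1\<close>, yields its properties.\<close>
    by (rule positive_densityI[OF assms(1,2) assms(3)[of 1] assms(6)[of 1 1]]) auto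
  interpret positive_density f by fact
  define X where "X M \<omega> = average_rate M (\<lambda>i. \<gamma> M i \<omega>) (\<lambda>i. h M i \<omega>) (l M \<omega>)" for M \<omega>
  define z where "z M \<omega> i = \<gamma> M i \<omega> * (cmod (h M i \<omega>))\<^sup>2" for M \<omega> i
  define D where "D A M \<omega> = survival_distance (survival f) A (2*M) (z M \<omega>)" for A M \<omega>
  define B where "B A M = (\<integral>\<^sup>+s. ennreal (min (2 * survival f s) (1 / sqrt (real (2*M)))) \<partial>log_measure A)" for A M

  have X_meas: "X M \<in> borel_measurable (P M)" for M
  proof (cases "1 \<le> M")
    case True
    interpret prob_space "P M" by (rule assms(3)[OF True])
    show ?thesis
      unfolding X_def[abs_def]
      using assms(5)[OF True] assms(7)[OF True] assms(9)[OF True]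
      by (intro borel_measurable_average_rate) (auto simp: indep_vars_def)
  \<comment> \<open>Nothing is assumed about \<open>P 0\<close>, but for \<open>M = 0\<close> the
    average rate is constantly 0.\<close>
  qed (simp add: X_def[abs_def] average_rate_def not_le)
  have D_meas: "D A M \<in> borel_measurable (P M)"
    and D_le: "(\<integral>\<^sup>+\<omega>. D A M \<omega> \<partial>P M) \<le> B A M"
    if M: "1 \<le> M" and A: "A \<in> sets borel" for A M
  proof -
    interpret prob_space "P M" by (rule assms(3)[OF M])
    have "1 \<le> 2 * M" using M by simp
    note * = survival_distance_le[OF f this A assms(4)[OF M] assms(5)[OF M] assms(6)[OF M] assms(7)[OF M] assms(8)[OF M]]
    show "D A M \<in> borel_measurable (P M)"
      unfolding D_def[abs_def] z_def[abs_def] by (rule *(1))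
    show "(\<integral>\<^sup>+\<omega>. D A M \<omega> \<partial>P M) \<le> B A M"
      unfolding D_def z_def[abs_def] B_def by (rule *(2))
  qed
  \<comment> \<open>Common core of the finite and the infinite case: an event that forces the
    survival distance to be at least a fixed \<open>\<delta>\<close> becomes improbable, by Markov
    and the vanishing mean distance.\<close>
  have tendsto: "(\<lambda>M. measure (P M) {\<omega> \<in> space (P M). Q M \<omega>}) \<longlonglongrightarrow> 0"
    if A: "A \<in> sets borel" and fin: "(\<integral>\<^sup>+s. ennreal (survival f s) \<partial>log_measure A) < \<infinity>"
      and \<delta>: "0 < \<delta>"
      and Q: "\<And>M \<omega>. 1 \<le> M \<Longrightarrow> \<omega> \<in> space (P M) \<Longrightarrow> (\<And>i. i \<in> {1..2*M} \<Longrightarrow> 0 \<le> z M \<omega> i) \<Longrightarrow> Q M \<omega> \<Longrightarrow> ennreal \<delta> \<le> D A M \<omega>"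
    for A \<delta> Q
  proof (rule tendsto_measure_0I[where c = "ennreal (1 / \<delta>)" and B = "B A"])
    show "B A \<longlonglongrightarrow> 0"
      unfolding B_def[abs_def]
      by (rule tendsto_survival_bound[OF sets_log_measure borel_measurable_survival survival_nonneg fin])
    fix M :: nat assume M: "1 \<le> M"
    then interpret prob_space "P M" by (rule assms(3))
    have "AE \<omega> in P M. \<forall>i\<in>{1..2*M}. 0 < \<gamma> M i \<omega>"
      by (intro AE_finite_allI AE_positive_density[OF f] assms(6)[OF M]) auto
    then have "AE \<omega> in P M. \<omega> \<in> {\<omega> \<in> space (P M). Q M \<omega>} \<longrightarrow> ennreal \<delta> \<le> D A M \<omega>"
    proof eventually_elim
      case (elim \<omega>)
      have "0 \<le> z M \<omega> i" if "i \<in> {1..2*M}" for i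
      proof -
        have "0 < \<gamma> M i \<omega>" using elim that by blast
        then show ?thesis by (simp add: z_def)
      qed
      then show ?case using Q[OF M] by blast
    qed
    then have "emeasure (P M) {\<omega> \<in> space (P M). Q M \<omega>} \<le> ennreal (1 / \<delta>) * (\<integral>\<^sup>+\<omega>. D A M \<omega> \<partial>P M)"
      by (rule emeasure_le_Markov[OF D_meas[OF M A] \<delta>])
    also have "\<dots> \<le> ennreal (1 / \<delta>) * B A M"
      by (intro mult_left_mono D_le M A) simp
    finally show "emeasure (P M) {\<omega> \<in> space (P M). Q M \<omega>} \<le> ennreal (1 / \<delta>) * B A M" .
  qed (use assms(3) in auto)
  have S: "sum_ln_rate M (z M \<omega>) (l M \<omega>) / real M = 2 * ln 2 * X M \<omega>" for M \<omega>
    unfolding X_def average_rate_eq z_def[abs_def] by simp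
  have opt: "pairing M (l M \<omega>)" "\<And>l'. pairing M l' \<Longrightarrow> sum_ln_rate M (z M \<omega>) l' \<le> sum_ln_rate M (z M \<omega>) (l M \<omega>)"
    if "1 \<le> M" "\<omega> \<in> space (P M)" for M \<omega>
    using optimal_pairing_sum_ln_rate[OF assms(9)[OF that]] unfolding z_def[abs_def] by blast+

  show ?thesis
    unfolding tendsto_in_prob_def X_def[symmetric]
  proof (intro conjI allI X_meas, cases "limit_rate f = \<infinity>")
    case True
    then have L: "rate_integral = \<infinity>"
      by (auto simp: limit_rate_eq ennreal_mult_eq_top_iff)
    have inf: "(\<integral>\<^sup>+s. ennreal (survival f s) \<partial>log_measure UNIV) = \<infinity>"
    proof -
      have "2 * (\<integral>\<^sup>+s. ennreal (survival f s) \<partial>log_measure UNIV) = \<infinity>"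
        unfolding rate_integral_identity[symmetric] L by simp
      then show ?thesis by (simp add: ennreal_mult_eq_top_iff)
    qed
    have "(\<lambda>M. measure (P M) {\<omega> \<in> space (P M). X M \<omega> \<le> K}) \<longlonglongrightarrow> 0" for K
    proof -
      \<comment> \<open>The factor \<open>2 * ln 2\<close> converts the average rate to
        \<open>sum_ln_rate / M\<close>, and \<open>max 0\<close> keeps \<open>k\<close> nonnegative.
        Below, the extra 1 in \<open>k + 1\<close> is the gap that the distance must fill if the
        rate stays below \<open>K\<close>.\<close>
      define k where "k = 2 * ln 2 * max 0 K"
      obtain a where a: "ennreal (k + 1) < (\<integral>\<^sup>+s. ennreal (survival f s) \<partial>log_measure {..a})"
        using log_measure_atMost_exhaust[OF _ inf] by auto
      show ?thesis
      proof (rule tendsto[of "{..a}" 1])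
        show "(\<integral>\<^sup>+s. ennreal (survival f s) \<partial>log_measure {..a}) < \<infinity>"
          by (rule log_measure_atMost_finite) (simp_all add: survival_le_1)
        fix M \<omega>
        assume M: "1 \<le> M" "\<omega> \<in> space (P M)" and z: "\<And>i. i \<in> {1..2*M} \<Longrightarrow> 0 \<le> z M \<omega> i" and K: "X M \<omega> \<le> K"
        have "ennreal (2 * ln 2 * X M \<omega>) \<le> ennreal k"
          using K unfolding k_def by (intro ennreal_leI mult_left_mono) auto
        have "ennreal k + ennreal 1 = ennreal (k + 1)"
          by (rule ennreal_plus[symmetric]) (simp_all add: k_def)
        also have "\<dots> \<le> (\<integral>\<^sup>+s. ennreal (survival f s) \<partial>log_measure {..a})"
          using a by (rule less_imp_le)
        also have "\<dots> \<le> ennreal (2 * ln 2 * X M \<omega>) + D {..a} M \<omega>"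
          unfolding S[symmetric] D_def by (rule sum_ln_rate_lower[OF M(1) opt(1)[OF M] z opt(2)[OF M]]) simp_all
        also have "\<dots> \<le> ennreal k + D {..a} M \<omega>"
          by (rule add_right_mono) fact
        finally show "ennreal 1 \<le> D {..a} M \<omega>"
          by (simp add: ennreal_add_left_cancel_le)
      qed simp_all
    qed
    then show "if limit_rate f = \<infinity>
      then \<forall>K. (\<lambda>n. measure (P n) {\<omega> \<in> space (P n). X n \<omega> \<le> K}) \<longlonglongrightarrow> 0
      else \<forall>\<epsilon>>0. (\<lambda>n. measure (P n) {\<omega> \<in> space (P n). \<epsilon> < \<bar>X n \<omega> - enn2real (limit_rate f)\<bar>}) \<longlonglongrightarrow> 0"
      using True by simp
  next
    case False
    then have fin: "rate_integral < \<infinity>"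
      by (auto simp: limit_rate_eq ennreal_mult_eq_top_iff top.not_eq_extremum)
    define c where "c = enn2real (limit_rate f)"
    have c: "0 \<le> c" by (simp add: c_def)
    have L: "rate_integral = ennreal (2 * ln 2 * c)"
    proof -
      have "ennreal (2 * ln 2 * c) = ennreal (2 * ln 2) * (ennreal (1 / (2 * ln 2)) * rate_integral)"
        using False by (simp add: ennreal_mult' c_def top.not_eq_extremum flip: limit_rate_eq)
      also have "\<dots> = rate_integral"
        by (simp add: mult.assoc[symmetric] ennreal_mult'[symmetric])
      finally show ?thesis ..
    qed
    have "(\<lambda>M. measure (P M) {\<omega> \<in> space (P M). \<epsilon> < \<bar>X M \<omega> - c\<bar>}) \<longlonglongrightarrow> 0" if \<epsilon>: "0 < \<epsilon>" for \<epsilon>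
    \<comment> \<open>A deviation \<open>\<epsilon>\<close> of the average rate is one of
      \<open>2 * ln 2 * \<epsilon>\<close> in the natural scale, and this is at most 4 times the
      distance; hence \<open>ln 2 * \<epsilon> / 2\<close>.\<close>
    proof (rule tendsto[of UNIV "ln 2 * \<epsilon> / 2"])
      show "(\<integral>\<^sup>+s. ennreal (survival f s) \<partial>log_measure UNIV) < \<infinity>"
        using survival_integral_le_rate_integral fin by (rule le_less_trans)
      show "0 < ln 2 * \<epsilon> / 2" using \<epsilon> by simp
      fix M \<omega>
      assume M: "1 \<le> M" "\<omega> \<in> space (P M)" and z: "\<And>i. i \<in> {1..2*M} \<Longrightarrow> 0 \<le> z M \<omega> i" and far: "\<epsilon> < \<bar>X M \<omega> - c\<bar>"
      \<comment> \<open>Nonnegativity is needed to read the \<open>ennreal\<close> estimates back as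
        real inequalities.\<close>
      have X: "0 \<le> 2 * ln 2 * X M \<omega>"
        unfolding S[symmetric] using sum_ln_rate_nonneg[OF opt(1)[OF M] z] by simp
      note near = sum_ln_rate_near_rate_integral[OF M(1) opt(1)[OF M] z opt(2)[OF M] fin,
        unfolded S, folded D_def, unfolded L]
      show "ennreal (ln 2 * \<epsilon> / 2) \<le> D UNIV M \<omega>"
      proof (cases "D UNIV M \<omega>")
        case (real d)
        have "\<bar>2 * ln 2 * X M \<omega> - 2 * ln 2 * c\<bar> = 2 * ln 2 * \<bar>X M \<omega> - c\<bar>"
          by (simp add: right_diff_distrib[symmetric] abs_mult)
        then have "2 * ln 2 * \<epsilon> < \<bar>2 * ln 2 * X M \<omega> - 2 * ln 2 * c\<bar>"
          using far by simp
        moreover have "2 * ln 2 * X M \<omega> \<le> 2 * ln 2 * c + 4 * d"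
          using near(1) real c by (simp add: ennreal_mult'[symmetric] ennreal_plus[symmetric] ennreal_le_iff del: ennreal_plus flip: ennreal_numeral)
        moreover have "2 * ln 2 * c \<le> 2 * ln 2 * X M \<omega> + 4 * d"
          using near(2) real X by (simp add: ennreal_mult'[symmetric] ennreal_plus[symmetric] ennreal_le_iff del: ennreal_plus flip: ennreal_numeral)
        ultimately have "ln 2 * \<epsilon> / 2 \<le> d" by linarith
        then show ?thesis using real by (simp add: ennreal_leI)
      qed simp
    qed simp
    then show "if limit_rate f = \<infinity>
      then \<forall>K. (\<lambda>n. measure (P n) {\<omega> \<in> space (P n). X n \<omega> \<le> K}) \<longlonglongrightarrow> 0
      else \<forall>\<epsilon>>0. (\<lambda>n. measure (P n) {\<omega> \<in> space (P n). \<epsilon> < \<bar>X n \<omega> - enn2real (limit_rate f)\<bar>}) \<longlonglongrightarrow> 0"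
      using False by (simp add: c_def)
  qed
qed

end
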